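(* Let $f:[0,1]\times\mathbb{R}\to\mathbb{R}$ be a continuous function such that $f(t,0)\neq 0$ for all $t\in[0,1]$, and such that for every $t\in[0,1]$ the function $x\mapsto f(t,x)$ is nondecreasing on $\mathbb{R}$. Then there exists $x\in H_0^1(0,1)\cap C^2(0,1)$ which is the unique solution of $$\ddot{x}(t)=f(t,x(t)),\qquad x(0)=x(1)=0,$$ and for each $n\in\mathbb{N}$ there exists $x^n:\{0,1,\dots,n\}\to\mathbb{R}$ which is the unique solution of $$\Delta^2x^n(k-1)=\frac{1}{n^2}f\left(\frac{k}{n},x^n(k)\right)\quad\text{for } k\in\{1,\dots,n-1\},\qquad x^n(0)=x^n(n)=0.$$ Moreover, there exists a subsequence $(x^{n_m})_{m}$ of $(x^n)_{n}$ such that $$\lim_{m\to\infty}\max_{0\leq k\leq n_m}\left|x^{n_m}(k)-x\left(\frac{k}{n_m}\right)\right|=0.$$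
   Context: $\mathbb{N}=\{1,2,\dots\}$. $\Delta$ is the forward difference operator: $\Delta x(k-1)=x(k)-x(k-1)$, so $\Delta^2x(k-1)=x(k+1)-2x(k)+x(k-1)$. $H_0^1(0,1)$ is the space of absolutely continuous functions $x:[0,1]\to\mathbb{R}$ with $x(0)=x(1)=0$ whose a.e. derivative $\dot x$ is square integrable. A solution of the continuous Dirichlet problem is understood as a weak solution, i.e. a function $x\in H_0^1(0,1)$ such that $$\int_0^1\dot x(t)\dot v(t)\,dt+\int_0^1 f(t,x(t))v(t)\,dt=0\quad\text{for all } v\in H_0^1(0,1);$$ since $f$ is continuous, such an $x$ is in fact twice continuously differentiable and satisfies the equation pointwise. *)

theory Defs
  imports "HOL-Analysis.Analysis"
begin

text \<open>
  The usual epsilon-delta absolute continuity of a function. A finite family of non-overlapping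
  closed subintervals is a division of its own union, and
  a degenerate member contributes nothing to either sum.
\<close>

definition abs_continuous_on_interval :: "real \<Rightarrow> real \<Rightarrow> (real \<Rightarrow> real) \<Rightarrow> bool" where
  "abs_continuous_on_interval a b x \<longleftrightarrow>
     (\<forall>\<epsilon>>0. \<exists>\<delta>>0. \<forall>\<D>. \<D> division_of \<Union>\<D> \<and> \<Union>\<D> \<subseteq> {a..b} \<and> (\<Sum>K\<in>\<D>. Sup K - Inf K) < \<delta>
        \<longrightarrow> (\<Sum>K\<in>\<D>. \<bar>x (Sup K) - x (Inf K)\<bar>) < \<epsilon>)"

text \<open>
  Elements of the Sobolev space are represented by total functions of which only the values on
  the closed unit interval matter. At an exceptional point where the derivative does not exist,
  \<open>deriv\<close> has an unspecified value; such points form a null set, which is irrelevant for the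
  Lebesgue (complete) measure. The almost everywhere existence of the derivative and its
  measurability follow from absolute continuity and are recorded only to make the phrase
  ``square integrable a.e. derivative'' explicit.
\<close>

definition H01 :: "(real \<Rightarrow> real) set" where
  "H01 = {x. abs_continuous_on_interval 0 1 x \<and> x 0 = 0 \<and> x 1 = 0 \<and>
             (AE t in lebesgue. t \<in> {0..1} \<longrightarrow> x differentiable (at t)) \<and>
             set_borel_measurable lebesgue {0..1} (deriv x) \<and>
             set_integrable lebesgue {0..1} (\<lambda>t. (deriv x t)\<^sup>2)}"

definition C2_on :: "real set \<Rightarrow> (real \<Rightarrow> real) \<Rightarrow> bool" where
  "C2_on S x \<longleftrightarrow> x C1_differentiable_on S \<and> deriv x C1_differentiable_on S"

definition weak_solution :: "(real \<Rightarrow> real \<Rightarrow> real) \<Rightarrow> (real \<Rightarrow> real) \<Rightarrow> bool" where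
  "weak_solution f x \<longleftrightarrow> x \<in> H01 \<and>
     (\<forall>v\<in>H01. (LINT t:{0..1}|lebesgue. deriv x t * deriv v t)
             + (LINT t:{0..1}|lebesgue. f t (x t) * v t) = 0)"

definition forward_diff :: "(nat \<Rightarrow> real) \<Rightarrow> nat \<Rightarrow> real" where
  "forward_diff u k = u (Suc k) - u k"

text \<open>
  A grid function on \<open>{0..n}\<close> is represented by a function on all naturals; the conditions below
  involve its values on \<open>{0..n}\<close> only.
\<close>

definition discrete_solution :: "(real \<Rightarrow> real \<Rightarrow> real) \<Rightarrow> nat \<Rightarrow> (nat \<Rightarrow> real) \<Rightarrow> bool" where
  "discrete_solution f n u \<longleftrightarrow>
     (\<forall>k\<in>{1..n-1}. (forward_diff ^^ 2) u (k - 1) = 1 / (real n)\<^sup>2 * f (real k / real n) (u k)) \<and>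
     u 0 = 0 \<and> u n = 0"

end

theory Submission
  imports Defs "HOL-Complex_Analysis.Great_Picard"
begin

text \<open>
  Monotonicity of \<open>f\<close> yields a discrete maximum principle, which bounds any grid function whose second
  differences are small where it is positive or negative. Shooting in the first increment together
  with the intermediate value theorem solves the discrete problem, and the maximum principle gives
  uniform bounds and equi-Lipschitz interpolants, so by Arzela-Ascoli a subsequence converges
  uniformly to some \<open>x\<close>. Let \<open>y\<close> solve the linear problem with right-hand side \<open>f t (x t)\<close>. The
  defect of \<open>y\<close> in the discrete equation is \<open>o(1/n\<^sup>2)\<close>, so by the maximum principle the subsequence
  converges to \<open>y\<close> as well; hence \<open>x = y\<close> is a classical solution and the convergence claim is
  already proved.

  It is a weak solution, and the only one, by the fundamental theorem of calculus for absolutely continuous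
  functions: for two weak solutions, testing the difference of the equations with the difference of
  the solutions and using monotonicity shows that their derivatives agree almost everywhere.
\<close>

section \<open>Discrete Dirichlet problems\<close>

lemma forward_diff_2: "(forward_diff ^^ 2) u k = u (Suc (Suc k)) - 2 * u (Suc k) + u k"
  by (simp add: numeral_2_eq_2 forward_diff_def)

text \<open>Shifting the index removes the truncated subtraction \<open>k - 1\<close>, so that later
  arguments run over \<open>Suc k < n\<close>.\<close>

lemma discrete_solution_iff:
  "discrete_solution f n u \<longleftrightarrow> u 0 = 0 \<and> u n = 0 \<and>
     (\<forall>k. Suc k < n \<longrightarrow>
        (forward_diff ^^ 2) u k = f (real (Suc k) / real n) (u (Suc k)) / (real n)\<^sup>2)"
proof -
  have "(\<forall>k\<in>{1..n-1}. P (k - 1) k) \<longleftrightarrow> (\<forall>k. Suc k < n \<longrightarrow> P k (Suc k))" for P :: "nat \<Rightarrow> nat \<Rightarrow> bool"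
  proof
    assume L: "\<forall>k\<in>{1..n-1}. P (k - 1) k"
    show "\<forall>k. Suc k < n \<longrightarrow> P k (Suc k)"
    proof (intro allI impI)
      fix k assume "Suc k < n"
      then show "P k (Suc k)" using L[rule_format, of "Suc k"] by simp
    qed
  next
    assume R: "\<forall>k. Suc k < n \<longrightarrow> P k (Suc k)"
    show "\<forall>k\<in>{1..n-1}. P (k - 1) k"
    proof
      fix k assume "k \<in> {1..n-1}"
      then show "P (k - 1) k" using R[rule_format, of "k - 1"] by auto
    qed
  qed
  from this[of "\<lambda>i k. (forward_diff ^^ 2) u i = 1 / (real n)\<^sup>2 * f (real k / real n) (u k)"]
  show ?thesis unfolding discrete_solution_def by auto
qed

text \<open>At the first positive value the preceding one is \<le> 0, so the increment there is
  positive. Convexity at positive values keeps later increments positive, so \<open>w\<close> would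
  still be positive at \<open>n\<close>. Asking for convexity only where \<open>w\<close> is
  positive is what makes the principle fit a monotone nonlinearity.\<close>

lemma discrete_maximum_principle:
  fixes w :: "nat \<Rightarrow> real"
  assumes "w 0 \<le> 0" "w n \<le> 0"
    and convex: "\<And>k. Suc k < n \<Longrightarrow> 0 < w (Suc k) \<Longrightarrow> 0 \<le> (forward_diff ^^ 2) w k"
    and "k \<le> n"
  shows "w k \<le> 0"
proof (rule ccontr)
  assume "\<not> w k \<le> 0"
  define j where "j = (LEAST j. 0 < w j)"
  have "0 < w k" using \<open>\<not> w k \<le> 0\<close> by simp
  then have j: "0 < w j" "\<And>i. i < j \<Longrightarrow> w i \<le> 0" "j \<le> k"
    unfolding j_def by (rule LeastI, metis not_less_Least not_le, rule Least_le)
  then obtain i where i: "j = Suc i" using assms(1) by (cases j) auto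
  have "0 < w (Suc (i + m)) \<and> w (i + m) < w (Suc (i + m))" if "Suc (i + m) \<le> n" for m
    using that
  proof (induction m)
    case 0
    then show ?case using j(1) j(2)[of i] i by simp
  next
    case (Suc m)
    then have "0 < w (Suc (i + m))" "w (i + m) < w (Suc (i + m))" by auto
    moreover have "0 \<le> w (Suc (Suc (i + m))) - 2 * w (Suc (i + m)) + w (i + m)"
      using convex[of "i + m"] Suc calculation by (simp add: forward_diff_2)
    ultimately show ?case by simp
  qed
  \<comment> \<open>This choice of \<open>m\<close> makes \<open>Suc (i + m)\<close> the right
    endpoint \<open>n\<close>.\<close>
  from this[of "n - Suc i"] show False
    using assms(2,4) j(3) i by auto
qed

text \<open>The comparison function \<open>k \<mapsto> c k (n - k) / n\<^sup>2\<close> has second difference \<open>- 2 c / n\<^sup>2\<close>.\<close>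

lemma discrete_one_sided_bound:
  fixes w :: "nat \<Rightarrow> real"
  assumes "w 0 = 0" "w n = 0" "0 \<le> c"
    and bound: "\<And>k. Suc k < n \<Longrightarrow> 0 < w (Suc k) \<Longrightarrow> - c / (real n)\<^sup>2 \<le> (forward_diff ^^ 2) w k"
    and "k \<le> n"
  shows "w k \<le> c"
proof (cases "n = 0")
  case True
  then show ?thesis using assms by simp
next
  case False
  define p where "p k = c * real k * (real n - real k) / (real n)\<^sup>2" for k
  have p: "0 \<le> p k" "p k \<le> c" if "k \<le> n" for k
  proof -
    show "0 \<le> p k" using that \<open>0 \<le> c\<close> by (simp add: p_def)
    have "real k * (real n - real k) \<le> real n * real n"
      using that by (intro mult_mono) auto
    then have "c * (real k * (real n - real k)) \<le> c * (real n)\<^sup>2"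
      using \<open>0 \<le> c\<close> by (simp add: mult_left_mono power2_eq_square)
    then show "p k \<le> c" using False by (simp add: p_def divide_simps mult.assoc)
  qed
  have "w k - p k \<le> 0"
  proof (rule discrete_maximum_principle[where n = n and w = "\<lambda>k. w k - p k"])
    \<comment> \<open>As \<open>p\<close> is nonnegative, \<open>w\<close> is positive wherever
      \<open>w - p\<close> is, so the hypothesis on \<open>w\<close> applies. The term
      \<open>- p\<close> contributes \<open>2 * c / n^2\<close>, which outweighs the possible
      \<open>- c / n^2\<close>.\<close>
    fix k assume k: "Suc k < n" "0 < w (Suc k) - p (Suc k)"
    then have "- c / (real n)\<^sup>2 \<le> (forward_diff ^^ 2) w k"
      using bound p(1)[of "Suc k"] by simp
    moreover have "(forward_diff ^^ 2) p k = - 2 * c / (real n)\<^sup>2"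
      using False by (simp add: forward_diff_2 p_def field_simps)
    moreover have "- 2 * c / (real n)\<^sup>2 \<le> - c / (real n)\<^sup>2"
      using \<open>0 \<le> c\<close> by (intro divide_right_mono) auto
    ultimately show "0 \<le> (forward_diff ^^ 2) (\<lambda>k. w k - p k) k"
      by (simp add: forward_diff_2)
  qed (use assms p in \<open>auto simp: p_def\<close>)
  then show ?thesis using p(2) \<open>k \<le> n\<close> by force
qed

text \<open>The one-sided bound for \<open>w\<close> and for \<open>- w\<close>. Each second
  difference condition is confined to one sign of \<open>w\<close>, since that is where monotonicity
  of \<open>f\<close> gives information.\<close>

lemma discrete_bound:
  fixes w :: "nat \<Rightarrow> real"
  assumes "w 0 = 0" "w n = 0" "0 \<le> c"
    and "\<And>k. Suc k < n \<Longrightarrow> 0 < w (Suc k) \<Longrightarrow> - c / (real n)\<^sup>2 \<le> (forward_diff ^^ 2) w k"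
    and "\<And>k. Suc k < n \<Longrightarrow> w (Suc k) < 0 \<Longrightarrow> (forward_diff ^^ 2) w k \<le> c / (real n)\<^sup>2"
    and "k \<le> n"
  shows "\<bar>w k\<bar> \<le> c"
proof -
  have "w k \<le> c" by (rule discrete_one_sided_bound[OF assms(1-4,6)])
  moreover have "- w k \<le> c"
  proof (rule discrete_one_sided_bound[where w = "\<lambda>k. - w k" and n = n])
    fix k assume "Suc k < n" "0 < - w (Suc k)"
    then show "- c / (real n)\<^sup>2 \<le> (forward_diff ^^ 2) (\<lambda>k. - w k) k"
      using assms(5)[of k] by (simp add: forward_diff_2)
  qed (use assms in auto)
  ultimately show ?thesis by simp
qed

text \<open>Where \<open>u - v\<close> is positive, monotonicity makes its second difference
  nonnegative, and symmetrically where it is negative; so the bound holds with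
  \<open>c = 0\<close>.\<close>

lemma discrete_solution_unique:
  assumes mono: "\<And>t. t \<in> {0..1} \<Longrightarrow> mono (f t)"
    and u: "discrete_solution f n u" and v: "discrete_solution f n v" and "k \<le> n"
  shows "u k = v k"
proof -
  have "\<bar>u k - v k\<bar> \<le> 0"
  proof (rule discrete_bound[where w = "\<lambda>k. u k - v k" and n = n])
    fix k assume k: "Suc k < n"
    let ?t = "real (Suc k) / real n"
    have t: "?t \<in> {0..1}" using k by simp
    have eq: "(forward_diff ^^ 2) (\<lambda>k. u k - v k) k = (f ?t (u (Suc k)) - f ?t (v (Suc k))) / (real n)\<^sup>2"
    proof -
      have "(forward_diff ^^ 2) (\<lambda>k. u k - v k) k = (forward_diff ^^ 2) u k - (forward_diff ^^ 2) v k"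
        by (simp add: forward_diff_2)
      also have "\<dots> = f ?t (u (Suc k)) / (real n)\<^sup>2 - f ?t (v (Suc k)) / (real n)\<^sup>2"
        using u v k unfolding discrete_solution_iff by presburger
      finally show ?thesis by (simp add: diff_divide_distrib)
    qed
    show "- 0 / (real n)\<^sup>2 \<le> (forward_diff ^^ 2) (\<lambda>k. u k - v k) k" if "0 < u (Suc k) - v (Suc k)"
      unfolding eq using monoD[OF mono[OF t], of "v (Suc k)" "u (Suc k)"] that by simp
    show "(forward_diff ^^ 2) (\<lambda>k. u k - v k) k \<le> 0 / (real n)\<^sup>2" if "u (Suc k) - v (Suc k) < 0"
      unfolding eq using monoD[OF mono[OF t], of "u (Suc k)" "v (Suc k)"] that
      by (simp add: divide_nonpos_nonneg)
  qed (use u v \<open>k \<le> n\<close> in \<open>auto simp: discrete_solution_iff\<close>)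
  then show ?thesis by simp
qed

section \<open>Existence on the grid by shooting in the first increment\<close>

fun shoot :: "(nat \<Rightarrow> real \<Rightarrow> real) \<Rightarrow> real \<Rightarrow> nat \<Rightarrow> real" where
  "shoot g s 0 = 0"
| "shoot g s (Suc 0) = s"
| "shoot g s (Suc (Suc k)) = 2 * shoot g s (Suc k) - shoot g s k + g (Suc k) (shoot g s (Suc k))"

lemma continuous_on_shoot:
  assumes "\<And>k. Suc k < n \<Longrightarrow> continuous_on UNIV (g (Suc k))" "k \<le> n"
  shows "continuous_on UNIV (\<lambda>s. shoot g s k)"
  using assms(2)
proof (induction k rule: less_induct)
  case (less k)
  consider "k = 0" | "k = Suc 0" | i where "k = Suc (Suc i)"
    by (metis not0_implies_Suc)
  then show ?case
  proof cases
    case 3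
    have c: "continuous_on UNIV (\<lambda>s. shoot g s (Suc i))" "continuous_on UNIV (\<lambda>s. shoot g s i)"
      using less 3 by auto
    have "continuous_on UNIV (\<lambda>s. g (Suc i) (shoot g s (Suc i)))"
      using continuous_on_compose2[OF assms(1) c(1)] less.prems 3 by auto
    then show ?thesis using c 3 by (auto intro!: continuous_intros)
  qed auto
qed

text \<open>The gap between two trajectories starts with increment \<open>s' - s\<close>, and a
  monotone \<open>g\<close> can only enlarge later increments as long as the gap is nonnegative;
  both facts are carried through one induction. Consequently the terminal value grows at least
  linearly in \<open>s\<close>.\<close>

lemma shoot_expanding:
  assumes mono: "\<And>k. Suc k < n \<Longrightarrow> mono (g (Suc k))" and "s \<le> s'" "k < n"
  shows "shoot g s k \<le> shoot g s' k \<and>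
    shoot g s' k - shoot g s k + (s' - s) \<le> shoot g s' (Suc k) - shoot g s (Suc k)"
  using \<open>k < n\<close>
proof (induction k)
  case (Suc k)
  then have IH: "shoot g s k \<le> shoot g s' k"
    "shoot g s' k - shoot g s k + (s' - s) \<le> shoot g s' (Suc k) - shoot g s (Suc k)" by auto
  then have "shoot g s (Suc k) \<le> shoot g s' (Suc k)" using \<open>s \<le> s'\<close> by simp
  moreover from this have "g (Suc k) (shoot g s (Suc k)) \<le> g (Suc k) (shoot g s' (Suc k))"
    using mono Suc.prems by (auto simp: mono_def)
  ultimately show ?case using IH by simp
qed (use assms in simp)

lemma discrete_solution_exists:
  assumes cont: "\<And>t. t \<in> {0..1} \<Longrightarrow> continuous_on UNIV (f t)"
    and mono: "\<And>t. t \<in> {0..1} \<Longrightarrow> mono (f t)" and "1 \<le> n"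
  shows "\<exists>u. discrete_solution f n u"
proof -
  define g where "g k x = f (real k / real n) x / (real n)\<^sup>2" for k x
  obtain m where m: "n = Suc m" using \<open>1 \<le> n\<close> by (cases n) auto
  have g_cont: "continuous_on UNIV (g (Suc k))" if "Suc k < n" for k
  proof -
    have "continuous_on UNIV (f (real (Suc k) / real n))" using that by (intro cont) auto
    then show ?thesis unfolding g_def using \<open>1 \<le> n\<close> by (auto intro!: continuous_intros)
  qed
  have g_mono: "mono (g (Suc k))" if "Suc k < n" for k
  proof -
    have "mono (f (real (Suc k) / real n))" using that by (intro mono) auto
    then show ?thesis unfolding g_def by (auto simp: mono_def intro!: divide_right_mono)
  qed
  have grow: "s' - s \<le> shoot g s' n - shoot g s n" if "s \<le> s'" for s s'
    using shoot_expanding[of n g s s' m, OF g_mono that] m that by auto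
  \<comment> \<open>Moving the slope by \<open>a\<close> moves the terminal value by at least
    \<open>a\<close>, enough to reach zero from \<open>shoot g 0 n\<close> in either
    direction.\<close>
  define a where "a = \<bar>shoot g 0 n\<bar>"
  have "\<exists>s\<ge>-a. s \<le> a \<and> shoot g s n = 0"
  proof (rule IVT')
    show "shoot g (- a) n \<le> 0" using grow[of "- a" 0] by (auto simp: a_def)
    show "0 \<le> shoot g a n" using grow[of 0 a] by (auto simp: a_def)
    show "continuous_on {- a..a} (\<lambda>s. shoot g s n)"
      using continuous_on_shoot[of n g n, OF g_cont] continuous_on_subset by blast
  qed (simp add: a_def)
  then obtain s where "shoot g s n = 0" by blast
  then have "discrete_solution f n (shoot g s)"
    unfolding discrete_solution_iff by (simp add: forward_diff_2 g_def)
  then show ?thesis by blast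
qed

text \<open>Where \<open>u\<close> is positive, monotonicity gives \<open>f t u\<close> \<ge>
  \<open>f t 0\<close> \<ge> \<open>- M\<close>, and symmetrically where it is negative. Values of
  \<open>f\<close> on the zero line thus control all discrete solutions, uniformly in
  \<open>n\<close>.\<close>

lemma discrete_solution_bound:
  assumes mono: "\<And>t. t \<in> {0..1} \<Longrightarrow> mono (f t)"
    and M: "\<And>t. t \<in> {0..1} \<Longrightarrow> \<bar>f t 0\<bar> \<le> M"
    and u: "discrete_solution f n u" and "k \<le> n"
  shows "\<bar>u k\<bar> \<le> M"
proof (rule discrete_bound[where n = n])
  show "0 \<le> M" using M[of 0] by simp
  fix k assume k: "Suc k < n"
  let ?t = "real (Suc k) / real n"
  have t: "?t \<in> {0..1}" using k by simp
  have eq: "(forward_diff ^^ 2) u k = f ?t (u (Suc k)) / (real n)\<^sup>2"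
    using u k unfolding discrete_solution_iff by simp
  show "- M / (real n)\<^sup>2 \<le> (forward_diff ^^ 2) u k" if "0 < u (Suc k)"
    unfolding eq using monoD[OF mono[OF t], of 0 "u (Suc k)"] M[OF t] that
    by (intro divide_right_mono) auto
  show "(forward_diff ^^ 2) u k \<le> M / (real n)\<^sup>2" if "u (Suc k) < 0"
    unfolding eq using monoD[OF mono[OF t], of "u (Suc k)" 0] M[OF t] that
    by (intro divide_right_mono) auto
qed (use u \<open>k \<le> n\<close> in \<open>auto simp: discrete_solution_iff\<close>)

text \<open>The increments average to zero and vary by at most \<open>L / n\<close>.\<close>

lemma discrete_lipschitz:
  fixes u :: "nat \<Rightarrow> real"
  assumes "u 0 = 0" "u n = 0" "0 \<le> L"
    and bound: "\<And>k. Suc k < n \<Longrightarrow> \<bar>(forward_diff ^^ 2) u k\<bar> \<le> L / (real n)\<^sup>2"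
    and "i \<le> n" "j \<le> n"
  shows "\<bar>u i - u j\<bar> \<le> L * \<bar>real i / real n - real j / real n\<bar>"
proof (cases "n = 0")
  case True
  then show ?thesis using assms by simp
next
  case False
  define d where "d = forward_diff u"
  have d2: "\<bar>d (Suc k) - d k\<bar> \<le> L / (real n)\<^sup>2" if "Suc k < n" for k
    using bound[OF that] by (simp add: d_def forward_diff_def numeral_2_eq_2)
  have step: "\<bar>d (k + m) - d k\<bar> \<le> real m * (L / (real n)\<^sup>2)" if "k + m < n" for k m
    using that
  proof (induction m)
    case (Suc m)
    then have "\<bar>d (k + m) - d k\<bar> \<le> real m * (L / (real n)\<^sup>2)" by simp
    moreover have "\<bar>d (Suc (k + m)) - d (k + m)\<bar> \<le> L / (real n)\<^sup>2" using d2 Suc.prems by simp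
    ultimately have "\<bar>d (Suc (k + m)) - d k\<bar> \<le> real m * (L / (real n)\<^sup>2) + L / (real n)\<^sup>2"
      by linarith
    then show ?case by (simp add: distrib_right add.commute add_divide_distrib)
  qed simp
  have osc_le: "\<bar>d l - d k\<bar> \<le> L / real n" if "k \<le> l" "l < n" for k l
  proof -
    have "\<bar>d l - d k\<bar> \<le> real (l - k) * (L / (real n)\<^sup>2)" using step[of k "l - k"] that by simp
    also have "\<dots> \<le> real n * (L / (real n)\<^sup>2)"
      using that \<open>0 \<le> L\<close> by (intro mult_right_mono) auto
    also have "\<dots> = L / real n" using False by (simp add: power2_eq_square)
    finally show ?thesis .
  qed
  have osc: "\<bar>d k - d l\<bar> \<le> L / real n" if "k < n" "l < n" for k l
    using osc_le[of k l] osc_le[of l k] that by (cases "k \<le> l") (auto simp: abs_minus_commute)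
  have tele: "sum d {..<m} = u m" for m
    unfolding d_def using \<open>u 0 = 0\<close> by (induction m) (auto simp: forward_diff_def)
  have dL: "\<bar>d k\<bar> \<le> L / real n" if "k < n" for k
  proof -
    \<comment> \<open>The increments \<open>d l\<close> sum to \<open>u n = 0\<close>, so
      subtracting them changes nothing and leaves only oscillations, each at most
      \<open>L / n\<close>.\<close>
    have "real n * d k = (\<Sum>l<n. d k - d l)"
      using tele[of n] \<open>u n = 0\<close> by (simp add: sum_subtractf)
    also have "\<bar>\<dots>\<bar> \<le> (\<Sum>l<n. L / real n)"
      using osc[OF that] by (intro order_trans[OF sum_abs] sum_mono) auto
    finally show ?thesis using False by (simp add: abs_mult field_simps)
  qed
  have lip: "\<bar>u (k + m) - u k\<bar> \<le> real m * (L / real n)" if "k + m \<le> n" for k m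
    using that
  proof (induction m)
    case (Suc m)
    then have "\<bar>u (k + m) - u k\<bar> \<le> real m * (L / real n)" by simp
    moreover have "\<bar>u (Suc (k + m)) - u (k + m)\<bar> \<le> L / real n"
      using dL[of "k + m"] Suc.prems by (simp add: d_def forward_diff_def)
    ultimately have "\<bar>u (Suc (k + m)) - u k\<bar> \<le> real m * (L / real n) + L / real n" by linarith
    then show ?case by (simp add: distrib_right add.commute add_divide_distrib)
  qed simp
  have *: "\<bar>u l - u k\<bar> \<le> L * \<bar>real l / real n - real k / real n\<bar>" if "k \<le> l" "l \<le> n" for k l
  proof -
    have "\<bar>u l - u k\<bar> \<le> (real l - real k) * (L / real n)" using lip[of k "l - k"] that by (simp add: of_nat_diff)
    also have "\<dots> = L * ((real l - real k) / real n)" by simp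
    also have "(real l - real k) / real n = \<bar>real l / real n - real k / real n\<bar>"
      using that by (simp add: diff_divide_distrib[symmetric])
    finally show ?thesis .
  qed
  show ?thesis
  proof (cases "i \<le> j")
    case True
    show ?thesis using *[OF True \<open>j \<le> n\<close>] by (simp only: abs_minus_commute)
  next
    case False
    then show ?thesis using *[OF _ \<open>i \<le> n\<close>, of j] by simp
  qed
qed

section \<open>Convergence of the discrete solutions\<close>

text \<open>Integrate twice and subtract the affine function with the same boundary values. Working
  on the whole line makes the derivatives at 0 and 1 two-sided.\<close>

lemma linear_dirichlet_exists:
  fixes g :: "real \<Rightarrow> real"
  assumes "continuous_on UNIV g"
  shows "\<exists>y p. (\<forall>t. (y has_real_derivative p t) (at t)) \<and> (\<forall>t. (p has_real_derivative g t) (at t)) \<and>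
    y 0 = 0 \<and> y 1 = 0"
proof -
  have antiderivative: "\<exists>F. \<forall>t. (F has_real_derivative h t) (at t)"
    if "continuous_on UNIV h" for h :: "real \<Rightarrow> real"
    using that einterval_antiderivative[of "-\<infinity>" "\<infinity>" h]
    by (auto simp: continuous_on_eq_continuous_at has_real_derivative_iff_has_vector_derivative)
  obtain P where P: "\<And>t. (P has_real_derivative g t) (at t)"
    using antiderivative[OF assms] by blast
  have "continuous_on UNIV P"
    using P by (meson DERIV_isCont continuous_at_imp_continuous_on)
  then obtain Y where Y: "\<And>t. (Y has_real_derivative P t) (at t)"
    using antiderivative by blast
  have "((\<lambda>t. Y t - Y 0 - (Y 1 - Y 0) * t) has_real_derivative P t - (Y 1 - Y 0)) (at t)" for t
    by (rule derivative_eq_intros Y refl | simp)+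
  moreover have "((\<lambda>t. P t - (Y 1 - Y 0)) has_real_derivative g t) (at t)" for t
    by (rule derivative_eq_intros P refl | simp)+
  ultimately show ?thesis
    by (intro exI[of _ "\<lambda>t. Y t - Y 0 - (Y 1 - Y 0) * t"] exI[of _ "\<lambda>t. P t - (Y 1 - Y 0)"]) simp
qed

text \<open>The constant \<kappa> is chosen so that \<phi> takes equal values at 0 and
  \<open>h\<close>. Rolle's theorem then gives
  \<open>p (t + s) - p (t - s) = 2 * \<kappa> * s\<close>, and the mean value theorem for
  \<open>p\<close> identifies \<kappa> as a value of \<open>g\<close>.\<close>

lemma second_difference_mean_value:
  fixes y :: "real \<Rightarrow> real"
  assumes y: "\<And>t. (y has_real_derivative p t) (at t)" and p: "\<And>t. (p has_real_derivative g t) (at t)"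
    and "0 < h"
  shows "\<exists>\<xi>. \<bar>\<xi> - t\<bar> < h \<and> y (t + h) - 2 * y t + y (t - h) = h\<^sup>2 * g \<xi>"
proof -
  define \<kappa> where "\<kappa> = (y (t + h) - 2 * y t + y (t - h)) / h\<^sup>2"
  define \<phi> where "\<phi> s = y (t + s) + y (t - s) - \<kappa> * s\<^sup>2" for s
  have y': "((\<lambda>s. y (t + s)) has_real_derivative p (t + s)) (at s)"
    "((\<lambda>s. y (t - s)) has_real_derivative - p (t - s)) (at s)" for s
    by (rule DERIV_chain2[OF y, THEN DERIV_cong] derivative_eq_intros refl | simp)+
  have \<phi>: "(\<phi> has_real_derivative p (t + s) - p (t - s) - 2 * \<kappa> * s) (at s)" for s
    unfolding \<phi>_def by (rule derivative_eq_intros y' refl | simp)+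
  have "\<phi> h = \<phi> 0" using \<open>0 < h\<close> by (simp add: \<phi>_def \<kappa>_def)
  then obtain s where s: "0 < s" "s < h" "p (t + s) - p (t - s) - 2 * \<kappa> * s = 0"
    using MVT2[OF \<open>0 < h\<close>, of \<phi>, OF \<phi>] \<open>0 < h\<close> by fastforce
  obtain \<xi> where \<xi>: "t - s < \<xi>" "\<xi> < t + s" "p (t + s) - p (t - s) = (t + s - (t - s)) * g \<xi>"
    using MVT2[of "t - s" "t + s" p g] s p by auto
  have "\<kappa> = g \<xi>" using s \<xi> by simp
  then show ?thesis
    using \<xi> s \<open>0 < h\<close> by (intro exI[of _ \<xi>]) (auto simp: \<kappa>_def field_simps)
qed

text \<open>McShane's extension.\<close>

lemma lipschitz_interpolation:
  fixes \<tau> u :: "'a \<Rightarrow> real"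
  assumes "finite A" "A \<noteq> {}" "0 \<le> L"
    and lip: "\<And>i j. i \<in> A \<Longrightarrow> j \<in> A \<Longrightarrow> \<bar>u i - u j\<bar> \<le> L * \<bar>\<tau> i - \<tau> j\<bar>"
  shows "\<exists>F. (\<forall>i\<in>A. F (\<tau> i) = u i) \<and> (\<forall>s t. \<bar>F s - F t\<bar> \<le> L * \<bar>s - t\<bar>)"
proof (intro exI conjI allI ballI)
  define F where "F t = (MIN i\<in>A. u i + L * \<bar>t - \<tau> i\<bar>)" for t
  have le: "F t \<le> u i + L * \<bar>t - \<tau> i\<bar>" if "i \<in> A" for i t
    unfolding F_def using that assms(1) by simp
  have ge: "c \<le> F t" if "\<And>i. i \<in> A \<Longrightarrow> c \<le> u i + L * \<bar>t - \<tau> i\<bar>" for c t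
    unfolding F_def using that assms(1,2) by simp
  fix i assume i: "i \<in> A"
  \<comment> \<open>At \<open>\<tau> i\<close> the term with index \<open>i\<close> equals
    \<open>u i\<close>, and the Lipschitz condition says that no other term is smaller.\<close>
  have "u i \<le> F (\<tau> i)"
  proof (rule ge)
    fix j assume "j \<in> A"
    then show "u i \<le> u j + L * \<bar>\<tau> i - \<tau> j\<bar>" using lip[OF i] by fastforce
  qed
  then show "(MIN j\<in>A. u j + L * \<bar>\<tau> i - \<tau> j\<bar>) = u i"
    using le[OF i, of "\<tau> i"] by (simp add: F_def)
next
  define F where "F t = (MIN i\<in>A. u i + L * \<bar>t - \<tau> i\<bar>)" for t
  \<comment> \<open>Every term of the minimum is Lipschitz with constant \<open>L\<close>, so the
    one-sided estimate passes to the minimum; exchanging \<open>s\<close> and \<open>t\<close> gives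
    the other side.\<close>
  have *: "F s - L * \<bar>s - t\<bar> \<le> F t" for s t
  proof -
    have "F s - L * \<bar>s - t\<bar> \<le> u i + L * \<bar>t - \<tau> i\<bar>" if "i \<in> A" for i
    proof -
      have "F s \<le> u i + L * \<bar>s - \<tau> i\<bar>" unfolding F_def using that assms(1) by simp
      also have "L * \<bar>s - \<tau> i\<bar> \<le> L * (\<bar>s - t\<bar> + \<bar>t - \<tau> i\<bar>)"
        using \<open>0 \<le> L\<close> by (intro mult_left_mono) auto
      finally show ?thesis by (simp add: distrib_left)
    qed
    then show ?thesis using assms(1,2) unfolding F_def[of t] by simp
  qed
  fix s t
  show "\<bar>(MIN i\<in>A. u i + L * \<bar>s - \<tau> i\<bar>) - (MIN i\<in>A. u i + L * \<bar>t - \<tau> i\<bar>)\<bar> \<le> L * \<bar>s - t\<bar>"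
    using *[of s t] *[of t s] unfolding F_def by (simp add: abs_le_iff abs_minus_commute)
qed

section \<open>Compactness and identification of the limit\<close>

lemma bounded_on_compact:
  fixes h :: "'a::topological_space \<Rightarrow> real"
  assumes "compact K" "continuous_on K h"
  shows "\<exists>B\<ge>0. \<forall>z\<in>K. \<bar>h z\<bar> \<le> B"
proof -
  have "bounded (h ` K)" using assms by (intro compact_imp_bounded compact_continuous_image)
  then obtain B where "\<forall>z\<in>K. norm (h z) \<le> B" unfolding bounded_iff by auto
  then show ?thesis by (intro exI[of _ "max B 0"]) (auto simp: le_max_iff_disj)
qed

text \<open>The limit is produced on the whole line, as \<open>deriv\<close> at the endpoints
  requires, while the differential equation is tied to \<open>f\<close> only on the unit
  interval.\<close>

theorem discrete_solutions_subconverge: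
  fixes f :: "real \<Rightarrow> real \<Rightarrow> real"
  assumes cont: "continuous_on ({0..1} \<times> UNIV) (\<lambda>(t, x). f t x)"
    and mono: "\<And>t. t \<in> {0..1} \<Longrightarrow> mono (f t)"
    and X: "\<And>n. 1 \<le> n \<Longrightarrow> discrete_solution f n (X n)"
  obtains y p g :: "real \<Rightarrow> real" and r :: "nat \<Rightarrow> nat"
  where "\<And>t. (y has_real_derivative p t) (at t)" "\<And>t. (p has_real_derivative g t) (at t)"
    "continuous_on UNIV g" "\<And>t. t \<in> {0..1} \<Longrightarrow> g t = f t (y t)" "y 0 = 0" "y 1 = 0"
    "strict_mono r" "\<And>m. 1 \<le> r m"
    "\<And>\<epsilon>. 0 < \<epsilon> \<Longrightarrow> \<forall>\<^sub>F m in sequentially. \<forall>j\<le>r m. \<bar>X (r m) j - y (real j / real (r m))\<bar> \<le> \<epsilon>"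
proof -
  have cf: "continuous_on S (\<lambda>s. f (a s) (b s))"
    if "continuous_on S a" "continuous_on S b" "a ` S \<subseteq> {0..1}" for S :: "real set" and a b
  proof -
    have "continuous_on S (\<lambda>s. (\<lambda>(t, x). f t x) (a s, b s))"
      using that by (intro continuous_on_compose2[OF cont]) (auto intro: continuous_intros)
    then show ?thesis by simp
  qed
  obtain M where M: "0 \<le> M" "\<And>t. t \<in> {0..1} \<Longrightarrow> \<bar>f t 0\<bar> \<le> M"
    using bounded_on_compact[of "{0..1}" "\<lambda>t. f t 0"] cf[of "{0..1}" "\<lambda>t. t" "\<lambda>t. 0"] by auto
  have XM: "\<bar>X n j\<bar> \<le> M" if "1 \<le> n" "j \<le> n" for n j
    using discrete_solution_bound[OF mono M(2) X] that by blast
  have cfK: "continuous_on ({0..1} \<times> {-B..B}) (\<lambda>(t, x). f t x)" for B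
    using cont by (rule continuous_on_subset) auto
  \<comment> \<open>All values of all discrete solutions lie in this box, so a bound
    \<open>L\<close> for \<open>f\<close> on it bounds their second differences by
    \<open>L / n^2\<close>.\<close>
  have "compact ({0..1::real} \<times> {-M..M})" by (intro compact_Times compact_Icc)
  from bounded_on_compact[OF this cfK] obtain L where
    "0 \<le> L" and L_bound: "\<forall>z\<in>{0..1} \<times> {-M..M}. \<bar>case z of (t, x) \<Rightarrow> f t x\<bar> \<le> L" by blast
  have L: "\<bar>f t x\<bar> \<le> L" if "t \<in> {0..1}" "\<bar>x\<bar> \<le> M" for t x
    using L_bound[rule_format, of "(t, x)"] that by (auto simp: abs_le_iff)
  have lip: "\<bar>X n i - X n j\<bar> \<le> L * \<bar>real i / real n - real j / real n\<bar>"
    if "1 \<le> n" "i \<le> n" "j \<le> n" for n i j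
  proof (rule discrete_lipschitz)
    fix k assume k: "Suc k < n"
    then have "\<bar>f (real (Suc k) / real n) (X n (Suc k))\<bar> \<le> L"
      using XM[OF that(1), of "Suc k"] by (intro L) auto
    then show "\<bar>(forward_diff ^^ 2) (X n) k\<bar> \<le> L / (real n)\<^sup>2"
      using X[OF that(1)] k unfolding discrete_solution_iff by (simp add: divide_right_mono)
  qed (use X[OF that(1)] \<open>0 \<le> L\<close> that in \<open>auto simp: discrete_solution_iff\<close>)
  \<comment> \<open>The interpolant with index \<open>n\<close> belongs to the grid with
    \<open>Suc n\<close> steps, which excludes the empty grid; hence \<open>r m = Suc (k m)\<close>
    below.\<close>
  have "\<exists>F. (\<forall>j\<in>{0..Suc n}. F (real j / real (Suc n)) = X (Suc n) j) \<and>
      (\<forall>s t. \<bar>F s - F t\<bar> \<le> L * \<bar>s - t\<bar>)" for n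
    using lip[of "Suc n"] by (intro lipschitz_interpolation \<open>0 \<le> L\<close>) auto
  then obtain F where F: "\<And>n j. j \<le> Suc n \<Longrightarrow> F n (real j / real (Suc n)) = X (Suc n) j"
    "\<And>n s t. \<bar>F n s - F n t\<bar> \<le> L * \<bar>s - t\<bar>"
    unfolding atLeast0AtMost atMost_iff Ball_def by metis
  have F_bound: "norm (F n t) \<le> L" if "t \<in> {0..1}" for n t
  proof -
    have "F n 0 = 0" using F(1)[of 0 n] X[of "Suc n"] by (simp add: discrete_solution_iff)
    then have "norm (F n t) \<le> L * \<bar>t\<bar>" using F(2)[of n t 0] by simp
    also have "\<dots> \<le> L" using that \<open>0 \<le> L\<close> by (simp add: mult_left_le)
    finally show ?thesis .
  qed
  have F_equicont: "\<exists>d>0. \<forall>n t. t \<in> {0..1} \<and> norm (s - t) < d \<longrightarrow> norm (F n s - F n t) < e"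
    if "0 < e" for s e
  proof (intro exI[of _ "e / (L + 1)"] conjI allI impI)
    \<comment> \<open>The summand 1 covers the case \<open>L = 0\<close>.\<close>
    show "0 < e / (L + 1)" using that \<open>0 \<le> L\<close> by simp
    fix n t assume "t \<in> {0..1} \<and> norm (s - t) < e / (L + 1)"
    then have "(L + 1) * \<bar>s - t\<bar> < e" using \<open>0 \<le> L\<close> by (simp add: field_simps)
    moreover have "L * \<bar>s - t\<bar> \<le> (L + 1) * \<bar>s - t\<bar>" by (simp add: mult_right_mono)
    ultimately show "norm (F n s - F n t) < e" using F(2)[of n s t] by simp
  qed
  obtain x k where x: "continuous_on {0..1} x" and k: "strict_mono (k :: nat \<Rightarrow> nat)"
    and Fx: "\<And>e. 0 < e \<Longrightarrow> \<exists>N. \<forall>n t. n \<ge> N \<and> t \<in> {0..1} \<longrightarrow> norm (F (k n) t - x t) < e"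
    using Arzela_Ascoli[of "{0..1}" F L] F_bound F_equicont by auto
  \<comment> \<open>Clamping extends \<open>f t (x t)\<close> continuously from the unit interval to
    the line, where the linear problem is solved.\<close>
  define clamp where "clamp t = max 0 (min 1 t)" for t :: real
  have clamp: "clamp t \<in> {0..1}" "t \<in> {0..1} \<Longrightarrow> clamp t = t" for t
    by (auto simp: clamp_def)
  have clamp_cont: "continuous_on UNIV clamp" unfolding clamp_def by (intro continuous_intros)
  define g where "g t = f (clamp t) (x (clamp t))" for t
  have g: "continuous_on UNIV g" unfolding g_def
    using clamp by (intro cf clamp_cont continuous_on_compose2[OF x]) auto
  obtain y p where y: "\<And>t. (y has_real_derivative p t) (at t)"
    and p: "\<And>t. (p has_real_derivative g t) (at t)" and y01: "y 0 = 0" "y 1 = 0"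
    using linear_dirichlet_exists[OF g] by blast
  define r where "r m = Suc (k m)" for m
  have r: "strict_mono r" using k by (simp add: r_def strict_mono_def)
  obtain B where B: "\<And>t. t \<in> {0..1} \<Longrightarrow> \<bar>x t\<bar> \<le> B"
    using bounded_on_compact[OF compact_Icc x] by blast
  have inv: "(\<lambda>m. 1 / real (r m)) \<longlonglongrightarrow> 0"
    using LIMSEQ_subseq_LIMSEQ[OF lim_1_over_n[where 'a = real] r] by (simp add: o_def)
  have close_x: "\<forall>\<^sub>F m in sequentially. \<forall>j\<le>r m. \<bar>X (r m) j - x (real j / real (r m))\<bar> < \<delta>" if \<delta>: "0 < \<delta>" for \<delta>
  proof -
    obtain N where N: "\<And>n t. n \<ge> N \<Longrightarrow> t \<in> {0..1} \<Longrightarrow> \<bar>F (k n) t - x t\<bar> < \<delta>"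
      using Fx[OF \<delta>] by auto
    show ?thesis
    proof (rule eventually_sequentiallyI[of N], intro allI impI)
      fix m j assume "N \<le> m" "j \<le> r m"
      then have "real j / real (r m) \<in> {0..1}" by (auto simp: r_def)
      from N[OF \<open>N \<le> m\<close> this] show "\<bar>X (r m) j - x (real j / real (r m))\<bar> < \<delta>"
        using F(1)[of j "k m"] \<open>j \<le> r m\<close> by (simp add: r_def)
    qed
  qed
  have close_y: "\<forall>\<^sub>F m in sequentially. \<forall>j\<le>r m. \<bar>X (r m) j - y (real j / real (r m))\<bar> \<le> \<epsilon>"
    if \<epsilon>: "0 < \<epsilon>" for \<epsilon>
  proof -
    \<comment> \<open>A common bound for \<open>x\<close> and all \<open>X n\<close>, so that
      uniform continuity of \<open>f\<close> on one box compares their images.\<close>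
    define B' where "B' = max B M"
    have "uniformly_continuous_on ({0..1} \<times> {-B'..B'}) (\<lambda>(t, x). f t x)"
      using cfK by (intro compact_uniformly_continuous compact_Times) auto
    then obtain \<delta> where \<delta>: "0 < \<delta>" "\<And>z z'. z \<in> {0..1} \<times> {-B'..B'} \<Longrightarrow> z' \<in> {0..1} \<times> {-B'..B'} \<Longrightarrow>
        dist z' z < \<delta> \<Longrightarrow> dist (case z' of (t, x) \<Rightarrow> f t x) (case z of (t, x) \<Rightarrow> f t x) < \<epsilon> / 2"
      unfolding uniformly_continuous_on_def using half_gt_zero[OF \<epsilon>] by meson
    have f_unif: "\<bar>f t a - f t b\<bar> < \<epsilon> / 2"
      if "t \<in> {0..1}" "\<bar>a\<bar> \<le> B'" "\<bar>b\<bar> \<le> B'" "\<bar>a - b\<bar> < \<delta>" for t a b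
      using \<delta>(2)[of "(t, b)" "(t, a)"] that by (auto simp: abs_le_iff dist_Pair_Pair dist_real_def)
    have "uniformly_continuous_on {0..1} g"
      using continuous_on_subset[OF g] by (intro compact_uniformly_continuous) auto
    then obtain \<eta> where \<eta>: "0 < \<eta>" "\<And>s t. s \<in> {0..1} \<Longrightarrow> t \<in> {0..1} \<Longrightarrow> dist t s < \<eta> \<Longrightarrow>
        dist (g t) (g s) < \<epsilon> / 2"
      unfolding uniformly_continuous_on_def using half_gt_zero[OF \<epsilon>] by meson
    show ?thesis
      using close_x[OF \<delta>(1)] order_tendstoD(2)[OF inv \<eta>(1)]
    proof eventually_elim
      case (elim m)
      define n where "n = r m"
      have n: "1 \<le> n" "0 < real n" by (auto simp: n_def r_def)
      define w where "w j = X n j - y (real j / real n)" for j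
      \<comment> \<open>The error splits into two halves: replacing \<open>X n\<close> by
        \<open>x\<close> inside \<open>f\<close>, and moving from the node \<open>t\<close> to the
        intermediate point \<xi>, which is closer than \<open>1 / n\<close> to it.\<close>
      have defect: "\<bar>(forward_diff ^^ 2) w i\<bar> \<le> \<epsilon> / (real n)\<^sup>2" if i: "Suc i < n" for i
      proof -
        define t where "t = real (Suc i) / real n"
        have t: "t \<in> {0..1}" "1 / real n \<le> t" "t + 1 / real n \<le> 1"
          using i n by (auto simp: t_def field_simps)
        obtain \<xi> where \<xi>: "\<bar>\<xi> - t\<bar> < 1 / real n"
          "y (t + 1 / real n) - 2 * y t + y (t - 1 / real n) = (1 / real n)\<^sup>2 * g \<xi>"
          using second_difference_mean_value[OF y p, of "1 / real n" t] n by auto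
        have \<xi>01: "\<xi> \<in> {0..1}" using \<xi>(1) t by (auto simp: abs_less_iff)
        have nodes: "t + 1 / real n = real (Suc (Suc i)) / real n" "t - 1 / real n = real i / real n"
          using n by (auto simp: t_def field_simps)
        have y2: "y (real (Suc (Suc i)) / real n) - 2 * y (real (Suc i) / real n) + y (real i / real n)
            = g \<xi> / (real n)\<^sup>2"
          using \<xi>(2)[unfolded nodes] unfolding t_def by (simp add: power_divide)
        have X2: "(forward_diff ^^ 2) (X n) i = f t (X n (Suc i)) / (real n)\<^sup>2"
          using X[OF n(1)] i unfolding discrete_solution_iff t_def by blast
        have "(forward_diff ^^ 2) w i = (forward_diff ^^ 2) (X n) i
            - (y (real (Suc (Suc i)) / real n) - 2 * y (real (Suc i) / real n) + y (real i / real n))"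
          unfolding forward_diff_2 w_def by (simp only: algebra_simps)
        then have eq: "(forward_diff ^^ 2) w i = (f t (X n (Suc i)) - g \<xi>) / (real n)\<^sup>2"
          unfolding y2 X2 by (simp add: diff_divide_distrib)
        have "\<bar>X n (Suc i) - x t\<bar> < \<delta>" using elim(1)[rule_format, of "Suc i"] i by (simp add: n_def t_def)
        moreover have "\<bar>X n (Suc i)\<bar> \<le> B'" "\<bar>x t\<bar> \<le> B'"
          using XM[OF n(1), of "Suc i"] B[OF t(1)] i by (auto simp: B'_def)
        ultimately have "\<bar>f t (X n (Suc i)) - f t (x t)\<bar> < \<epsilon> / 2" using f_unif t(1) by blast
        moreover have "f t (x t) = g t" using clamp(2)[OF t(1)] by (simp add: g_def)
        moreover have "\<bar>g \<xi> - g t\<bar> < \<epsilon> / 2"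
          using \<eta>(2)[OF t(1) \<xi>01] \<xi>(1) elim(2) by (simp add: dist_real_def n_def)
        ultimately have "\<bar>f t (X n (Suc i)) - g \<xi>\<bar> \<le> \<epsilon>" by linarith
        then show ?thesis unfolding eq by (simp add: divide_right_mono)
      qed
      have "\<bar>w j\<bar> \<le> \<epsilon>" if "j \<le> n" for j
      proof (rule discrete_bound[OF _ _ _ _ _ that])
        show "w 0 = 0" "w n = 0" using X[OF n(1)] y01 n by (auto simp: w_def discrete_solution_iff)
        show "0 \<le> \<epsilon>" using \<epsilon> by simp
        fix i assume "Suc i < n"
        from defect[OF this] show "- \<epsilon> / (real n)\<^sup>2 \<le> (forward_diff ^^ 2) w i"
          "(forward_diff ^^ 2) w i \<le> \<epsilon> / (real n)\<^sup>2" by (auto simp: abs_le_iff)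
      qed
      then show ?case by (simp add: w_def n_def)
    qed
  qed
  have "x t = y t" if t: "t \<in> {0..1}" for t
  proof -
    \<comment> \<open>The nodes \<open>s m\<close> just below \<open>t\<close> converge to
      \<open>t\<close>. At them \<open>X (r m)\<close> is close to both \<open>x\<close> and
      \<open>y\<close>, so continuity forces \<open>x t = y t\<close>.\<close>
    define j where "j m = nat \<lfloor>t * real (r m)\<rfloor>" for m
    define s where "s m = real (j m) / real (r m)" for m
    have rpos: "0 < real (r m)" for m by (simp add: r_def)
    have j: "real (j m) \<le> t * real (r m)" "t * real (r m) - 1 < real (j m)" for m
      using t rpos[of m] by (auto simp: j_def)
    have s_le: "s m \<le> t" "t - 1 / real (r m) \<le> s m" for m
    proof -
      show "s m \<le> t" using j(1) rpos by (simp add: s_def pos_divide_le_eq)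
      have "t - 1 / real (r m) = (t * real (r m) - 1) / real (r m)"
        using rpos[of m] by (simp add: diff_divide_distrib)
      also have "\<dots> \<le> s m" unfolding s_def using j(2)[of m] by (intro divide_right_mono) auto
      finally show "t - 1 / real (r m) \<le> s m" .
    qed
    have s01: "s m \<in> {0..1}" for m using s_le(1)[of m] t by (auto simp: s_def)
    have j_le: "j m \<le> r m" for m
      using s01[of m] rpos[of m] by (auto simp: s_def)
    have "s \<longlonglongrightarrow> t"
    proof (rule tendsto_sandwich[where f = "\<lambda>m. t - 1 / real (r m)" and h = "\<lambda>m. t"])
      show "(\<lambda>m. t - 1 / real (r m)) \<longlonglongrightarrow> t" using tendsto_diff[OF tendsto_const inv] by simp
    qed (use s_le in auto)
    have "(\<lambda>m. x (s m)) \<longlonglongrightarrow> x t"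
      using continuous_on_tendsto_compose[OF x \<open>s \<longlonglongrightarrow> t\<close> t] s01 by simp
    from tendsto_diff[OF this isCont_tendsto_compose[OF DERIV_isCont[OF y] \<open>s \<longlonglongrightarrow> t\<close>]]
    have "(\<lambda>m. x (s m) - y (s m)) \<longlonglongrightarrow> x t - y t" .
    moreover have "(\<lambda>m. x (s m) - y (s m)) \<longlonglongrightarrow> 0"
    proof (rule tendstoI)
      fix e :: real assume e: "0 < e"
      have "0 < e / 2" using e by simp
      from close_x[OF this] close_y[OF this]
      show "\<forall>\<^sub>F m in sequentially. dist (x (s m) - y (s m)) 0 < e"
      proof eventually_elim
        case (elim m)
        have "\<bar>X (r m) (j m) - x (s m)\<bar> < e / 2" "\<bar>X (r m) (j m) - y (s m)\<bar> \<le> e / 2"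
          using elim j_le by (auto simp: s_def)
        then show ?case unfolding dist_real_def by linarith
      qed
    qed
    ultimately show ?thesis using LIMSEQ_unique by fastforce
  qed
  then have gf: "g t = f t (y t)" if "t \<in> {0..1}" for t using that clamp by (simp add: g_def)
  show thesis
    by (rule that[OF y p g gf y01 r _ close_y]) (auto simp: r_def)
qed

section \<open>Absolutely continuous functions\<close>

lemma abs_continuous_on_intervalD:
  assumes "abs_continuous_on_interval a b F" "0 < \<epsilon>"
  shows "\<exists>\<delta>>0. \<forall>\<D>. \<D> division_of \<Union>\<D> \<longrightarrow> \<Union>\<D> \<subseteq> {a..b} \<longrightarrow>
    (\<Sum>K\<in>\<D>. Sup K - Inf K) < \<delta> \<longrightarrow> (\<Sum>K\<in>\<D>. \<bar>F (Sup K) - F (Inf K)\<bar>) < \<epsilon>"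
  using assms(1)[unfolded abs_continuous_on_interval_def, rule_format, OF assms(2)] unfolding imp_conjL .

lemma division_of_real_bounds:
  assumes "\<D> division_of S" "S \<subseteq> {a..b::real}" "K \<in> \<D>"
  shows "Inf K \<le> Sup K" "Inf K \<in> {a..b}" "Sup K \<in> {a..b}"
proof -
  obtain u v where K: "K = cbox u v" using assms(1,3) by blast
  moreover have "K \<noteq> {}" "K \<subseteq> {a..b}" using assms by auto
  ultimately show "Inf K \<le> Sup K" "Inf K \<in> {a..b}" "Sup K \<in> {a..b}" by auto
qed

lemma abs_continuous_on_interval_subset:
  assumes "abs_continuous_on_interval a b F" "a \<le> c" "d \<le> b"
  shows "abs_continuous_on_interval c d F"
proof -
  have "{c..d} \<subseteq> {a..b}" using assms by auto
  then show ?thesis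
    using assms(1) unfolding abs_continuous_on_interval_def by (meson order_trans)
qed

lemma abs_continuous_imp_continuous_on:
  assumes "abs_continuous_on_interval a b F"
  shows "continuous_on {a..b} F"
  unfolding continuous_on_iff
proof (intro ballI allI impI)
  fix x e :: real assume x: "x \<in> {a..b}" and "0 < e"
  obtain d where d: "0 < d" "\<forall>\<D>. \<D> division_of \<Union>\<D> \<longrightarrow> \<Union>\<D> \<subseteq> {a..b} \<longrightarrow>
    (\<Sum>K\<in>\<D>. Sup K - Inf K) < d \<longrightarrow> (\<Sum>K\<in>\<D>. \<bar>F (Sup K) - F (Inf K)\<bar>) < e"
    using abs_continuous_on_intervalD[OF assms \<open>0 < e\<close>] by blast
  \<comment> \<open>A single interval is a division of itself, so both sums reduce to one
    term.\<close>
  have *: "\<bar>F v - F u\<bar> < e" if "a \<le> u" "u \<le> v" "v \<le> b" "v - u < d" for u v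
    using d(2)[rule_format, of "{{u..v}}"] that division_of_self[of u v] by auto
  show "\<exists>d>0. \<forall>y\<in>{a..b}. dist y x < d \<longrightarrow> dist (F y) (F x) < e"
  proof (intro exI[of _ d] conjI ballI impI d(1))
    fix y assume "y \<in> {a..b}" "dist y x < d"
    then show "dist (F y) (F x) < e"
      using *[of x y] *[of y x] x by (cases "x \<le> y") (auto simp: dist_real_def)
  qed
qed

lemma lipschitz_imp_abs_continuous:
  assumes "\<And>s t. s \<in> {a..b} \<Longrightarrow> t \<in> {a..b} \<Longrightarrow> \<bar>F s - F t\<bar> \<le> L * \<bar>s - t\<bar>"
  shows "abs_continuous_on_interval a b F"
  unfolding abs_continuous_on_interval_def
proof (intro allI impI)
  fix e :: real assume e: "0 < e"
  \<comment> \<open>A positive constant dominating \<open>L\<close>, which may be zero or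
    negative.\<close>
  define M where "M = max L 0 + 1"
  have M: "M > 0" "L \<le> M" by (auto simp: M_def)
  show "\<exists>d>0. \<forall>\<D>. \<D> division_of \<Union>\<D> \<and> \<Union>\<D> \<subseteq> {a..b} \<and> (\<Sum>K\<in>\<D>. Sup K - Inf K) < d
        \<longrightarrow> (\<Sum>K\<in>\<D>. \<bar>F (Sup K) - F (Inf K)\<bar>) < e"
  proof (intro exI[of _ "e / M"] conjI allI impI)
    show "0 < e / M" using e M by simp
    fix \<D> assume \<D>: "\<D> division_of \<Union>\<D> \<and> \<Union>\<D> \<subseteq> {a..b} \<and> (\<Sum>K\<in>\<D>. Sup K - Inf K) < e / M"
    have "(\<Sum>K\<in>\<D>. \<bar>F (Sup K) - F (Inf K)\<bar>) \<le> (\<Sum>K\<in>\<D>. M * (Sup K - Inf K))"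
    proof (rule sum_mono)
      fix K assume "K \<in> \<D>"
      then have K: "Inf K \<le> Sup K" "Inf K \<in> {a..b}" "Sup K \<in> {a..b}"
        using division_of_real_bounds \<D> by blast+
      then have "\<bar>F (Sup K) - F (Inf K)\<bar> \<le> L * (Sup K - Inf K)"
        using assms[of "Sup K" "Inf K"] by auto
      also have "\<dots> \<le> M * (Sup K - Inf K)" using M K by (simp add: mult_right_mono)
      finally show "\<bar>F (Sup K) - F (Inf K)\<bar> \<le> M * (Sup K - Inf K)" .
    qed
    also have "\<dots> < e"
      using \<D> M by (simp add: sum_distrib_left[symmetric] pos_less_divide_eq mult.commute)
    finally show "(\<Sum>K\<in>\<D>. \<bar>F (Sup K) - F (Inf K)\<bar>) < e" .
  qed
qed

text \<open>The common core of the closure under differences and products: half of the tolerance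
  goes to \<open>F\<close> and half to \<open>G\<close>, scaled by \<open>A\<close> and
  \<open>B\<close>.\<close>

lemma abs_continuous_bilinear_bound:
  assumes F: "abs_continuous_on_interval a b F" and G: "abs_continuous_on_interval a b G"
    and bd: "\<And>s t. s \<in> {a..b} \<Longrightarrow> t \<in> {a..b} \<Longrightarrow> \<bar>H s - H t\<bar> \<le> A * \<bar>F s - F t\<bar> + B * \<bar>G s - G t\<bar>"
    and AB: "0 < A" "0 < B"
  shows "abs_continuous_on_interval a b H"
  unfolding abs_continuous_on_interval_def
proof (intro allI impI)
  fix e :: real assume e: "0 < e"
  have "0 < e / (2 * A)" "0 < e / (2 * B)" using e AB by auto
  obtain d1 where d1: "0 < d1" "\<forall>\<D>. \<D> division_of \<Union>\<D> \<longrightarrow> \<Union>\<D> \<subseteq> {a..b} \<longrightarrow>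
      (\<Sum>K\<in>\<D>. Sup K - Inf K) < d1 \<longrightarrow> (\<Sum>K\<in>\<D>. \<bar>F (Sup K) - F (Inf K)\<bar>) < e / (2 * A)"
    using abs_continuous_on_intervalD[OF F \<open>0 < e / (2 * A)\<close>] by blast
  obtain d2 where d2: "0 < d2" "\<forall>\<D>. \<D> division_of \<Union>\<D> \<longrightarrow> \<Union>\<D> \<subseteq> {a..b} \<longrightarrow>
      (\<Sum>K\<in>\<D>. Sup K - Inf K) < d2 \<longrightarrow> (\<Sum>K\<in>\<D>. \<bar>G (Sup K) - G (Inf K)\<bar>) < e / (2 * B)"
    using abs_continuous_on_intervalD[OF G \<open>0 < e / (2 * B)\<close>] by blast
  show "\<exists>d>0. \<forall>\<D>. \<D> division_of \<Union>\<D> \<and> \<Union>\<D> \<subseteq> {a..b} \<and> (\<Sum>K\<in>\<D>. Sup K - Inf K) < d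
        \<longrightarrow> (\<Sum>K\<in>\<D>. \<bar>H (Sup K) - H (Inf K)\<bar>) < e"
  proof (intro exI[of _ "min d1 d2"] conjI allI impI)
    show "0 < min d1 d2" using d1 d2 by simp
    fix \<D> assume \<D>: "\<D> division_of \<Union>\<D> \<and> \<Union>\<D> \<subseteq> {a..b} \<and> (\<Sum>K\<in>\<D>. Sup K - Inf K) < min d1 d2"
    have "(\<Sum>K\<in>\<D>. \<bar>H (Sup K) - H (Inf K)\<bar>)
      \<le> (\<Sum>K\<in>\<D>. A * \<bar>F (Sup K) - F (Inf K)\<bar> + B * \<bar>G (Sup K) - G (Inf K)\<bar>)"
    proof (rule sum_mono)
      fix K assume "K \<in> \<D>"
      then have "Inf K \<in> {a..b}" "Sup K \<in> {a..b}"
        using division_of_real_bounds \<D> by blast+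
      then show "\<bar>H (Sup K) - H (Inf K)\<bar> \<le> A * \<bar>F (Sup K) - F (Inf K)\<bar> + B * \<bar>G (Sup K) - G (Inf K)\<bar>"
        by (intro bd)
    qed
    also have "\<dots> = A * (\<Sum>K\<in>\<D>. \<bar>F (Sup K) - F (Inf K)\<bar>) + B * (\<Sum>K\<in>\<D>. \<bar>G (Sup K) - G (Inf K)\<bar>)"
      by (simp add: sum.distrib sum_distrib_left)
    also have "\<dots> < A * (e / (2 * A)) + B * (e / (2 * B))"
      using \<D> d1(2)[rule_format, of \<D>] d2(2)[rule_format, of \<D>] AB by (intro add_strict_mono mult_strict_left_mono) auto
    also have "\<dots> = e" using AB by simp
    finally show "(\<Sum>K\<in>\<D>. \<bar>H (Sup K) - H (Inf K)\<bar>) < e" .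
  qed
qed

lemma abs_continuous_diff:
  assumes "abs_continuous_on_interval a b F" "abs_continuous_on_interval a b G"
  shows "abs_continuous_on_interval a b (\<lambda>t. F t - G t)"
  by (rule abs_continuous_bilinear_bound[OF assms, of _ 1 1]) auto

text \<open>Both factors are bounded on the compact interval, and the bound of each one multiplies
  the increments of the other.\<close>

lemma abs_continuous_mult:
  assumes "abs_continuous_on_interval a b F" "abs_continuous_on_interval a b G"
  shows "abs_continuous_on_interval a b (\<lambda>t. F t * G t)"
proof -
  have "\<exists>B>0. \<forall>t\<in>{a..b}. \<bar>H t\<bar> \<le> B" if "abs_continuous_on_interval a b H" for H :: "real \<Rightarrow> real"
  proof -
    have "bounded (H ` {a..b})"
      using abs_continuous_imp_continuous_on[OF that]
      by (intro compact_imp_bounded compact_continuous_image) auto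
    then show ?thesis by (force simp: bounded_pos)
  qed
  then obtain A B where A: "A > 0" "\<And>t. t \<in> {a..b} \<Longrightarrow> \<bar>F t\<bar> \<le> A"
    and B: "B > 0" "\<And>t. t \<in> {a..b} \<Longrightarrow> \<bar>G t\<bar> \<le> B"
    using assms by metis
  show ?thesis
  proof (rule abs_continuous_bilinear_bound[OF assms _ B(1) A(1)])
    fix s t assume st: "s \<in> {a..b}" "t \<in> {a..b}"
    have "F s * G s - F t * G t = G s * (F s - F t) + F t * (G s - G t)" by algebra
    also have "\<bar>\<dots>\<bar> \<le> \<bar>G s\<bar> * \<bar>F s - F t\<bar> + \<bar>F t\<bar> * \<bar>G s - G t\<bar>"
      by (metis abs_mult abs_triangle_ineq)
    also have "\<dots> \<le> B * \<bar>F s - F t\<bar> + A * \<bar>G s - G t\<bar>"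
      using A B st by (intro add_mono mult_right_mono) auto
    finally show "\<bar>F s * G s - F t * G t\<bar> \<le> B * \<bar>F s - F t\<bar> + A * \<bar>G s - G t\<bar>" .
  qed
qed

text \<open>Several tags can share an interval only if it is degenerate, and there \<open>d\<close>
  vanishes. This turns sums over tagged intervals into the sums over divisions that absolute
  continuity speaks about.\<close>

lemma sum_over_tagged_partial_division:
  fixes d :: "real set \<Rightarrow> real"
  assumes q: "q tagged_partial_division_of S" and "\<And>t. d {t} = 0"
  shows "(\<Sum>(t, K)\<in>q. d K) = sum d (snd ` q)"
proof -
  \<comment> \<open>The sum lemma also asks for value 0 at the empty interval, where
    \<open>d\<close> is arbitrary; intervals of a tagged family are never empty.\<close>
  define d' where "d' K = (if K = {} then 0 else d K)" for K
  have ne: "K \<noteq> {}" if "(t, K) \<in> q" for t K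
    using tagged_partial_division_ofD(2)[OF q that] by auto
  have "(\<Sum>(t, K)\<in>q. d' K) = sum d' (snd ` q)"
  proof (rule sum.over_tagged_division_lemma[OF tagged_partial_division_of_Union_self[OF q]])
    fix u v :: real assume "box u v = {}"
    then have "cbox u v = {} \<or> cbox u v = {u}" by auto
    then show "d' (cbox u v) = 0" using assms(2) by (auto simp: d'_def)
  qed
  moreover have "(\<Sum>(t, K)\<in>q. d' K) = (\<Sum>(t, K)\<in>q. d K)"
    using ne by (intro sum.cong) (auto simp: d'_def)
  moreover have "sum d' (snd ` q) = sum d (snd ` q)"
    using ne by (intro sum.cong) (auto simp: d'_def)
  ultimately show ?thesis by simp
qed

text \<open>The intervals of a fine division tagged in the exceptional null set have small total length,
  so absolute continuity bounds the increments over them.\<close>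

theorem fundamental_theorem_of_calculus_abs_continuous:
  fixes F :: "real \<Rightarrow> real"
  assumes "a \<le> b" and ac: "abs_continuous_on_interval a b F" and N: "negligible N"
    and der: "\<And>t. t \<in> {a..b} - N \<Longrightarrow> (F has_real_derivative g t) (at t within {a..b})"
  shows "(g has_integral F b - F a) {a..b}"
proof -
  \<comment> \<open>With value 0 on \<open>N\<close>, tags in \<open>N\<close> contribute nothing to
    the Riemann sum, only their increments of \<open>F\<close>.\<close>
  define h where "h t = (if t \<in> N then 0 else g t)" for t
  have "(h has_integral F b - F a) (cbox a b)"
    unfolding has_integral_factor_content
  proof safe
    fix e :: real assume "e > 0"
    show "\<exists>\<gamma>. gauge \<gamma> \<and> (\<forall>p. p tagged_division_of (cbox a b) \<and> \<gamma> fine p \<longrightarrow>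
      norm ((\<Sum>(x, k)\<in>p. measure lborel k *\<^sub>R h x) - (F b - F a)) \<le> e * measure lborel (cbox a b))"
    proof (cases "a = b")
      \<comment> \<open>The permitted error is zero here, but so are the Riemann sum and the
        increment.\<close>
      case True
      have "norm ((\<Sum>(x, k)\<in>p. measure lborel k *\<^sub>R h x) - (F b - F a)) \<le> e * measure lborel (cbox a b)"
        if "p tagged_division_of (cbox a b)" for p
        using sum_content_null[OF _ that, of h] True by simp
      then show ?thesis by (intro exI[of _ "\<lambda>x. ball x 1"]) (auto simp: gauge_ball)
    next
      case False
      \<comment> \<open>Half of the permitted error \<open>e * (b - a)\<close>; the other half is
        spent on the tags outside \<open>N\<close>.\<close>
      define e' where "e' = e * (b - a) / 2"
      have "e' > 0" "a < b" using False \<open>a \<le> b\<close> \<open>e > 0\<close> by (auto simp: e'_def)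
      obtain \<delta> where \<delta>: "0 < \<delta>" "\<forall>\<D>. \<D> division_of \<Union>\<D> \<longrightarrow> \<Union>\<D> \<subseteq> {a..b} \<longrightarrow>
        (\<Sum>K\<in>\<D>. Sup K - Inf K) < \<delta> \<longrightarrow> (\<Sum>K\<in>\<D>. \<bar>F (Sup K) - F (Inf K)\<bar>) < e'"
        using abs_continuous_on_intervalD[OF ac \<open>e' > 0\<close>] by blast
      have "\<exists>U. open U \<and> N \<subseteq> U \<and> U \<in> lmeasurable \<and> measure lebesgue U < \<delta>"
      proof -
        have "N \<in> null_sets lebesgue" using N by (simp add: negligible_iff_null_sets)
        then obtain U where U: "open U" "N \<subseteq> U" "(U - N) \<in> lmeasurable" "emeasure lebesgue (U - N) < ennreal \<delta>"
          using sets_lebesgue_outer_open[of N \<delta>] \<delta>(1) by auto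
        have eq: "U = (U - N) \<union> N" using U by auto
        have "N \<in> lmeasurable" using N by (simp add: negligible_imp_measurable)
        then have "U \<in> lmeasurable" using U(3) eq by (metis fmeasurable.Un)
        moreover have "emeasure lebesgue U < ennreal \<delta>"
          using U \<open>N \<in> null_sets lebesgue\<close> eq emeasure_Un_null_set[of "U - N" lebesgue N] by (simp add: fmeasurableD)
        ultimately show ?thesis using U \<delta>(1)
          by (metis emeasure_eq_measure2 ennreal_less_iff measure_nonneg)
      qed
      then obtain U where U: "open U" "N \<subseteq> U" "U \<in> lmeasurable" "measure lebesgue U < \<delta>" by blast
      \<comment> \<open>The two demands on the gauge: intervals tagged in \<open>N\<close> stay
        inside \<open>U\<close>, and elsewhere the derivative approximates increments with relative
        error \<open>e/2\<close>.\<close>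
      define good where "good x r \<longleftrightarrow> (x \<in> N \<longrightarrow> ball x r \<subseteq> U) \<and> (x \<in> {a..b} - N \<longrightarrow>
          (\<forall>y\<in>{a..b}. norm (y - x) < r \<longrightarrow> norm (F y - F x - g x * (y - x)) \<le> e/2 * norm (y - x)))" for x r
      have "\<exists>r>0. good x r" for x
      proof (cases "x \<in> N")
        case True
        then obtain r where "r > 0" "ball x r \<subseteq> U" using U open_contains_ball by blast
        then show ?thesis using True unfolding good_def by blast
      next
        case False
        show ?thesis
        proof (cases "x \<in> {a..b}")
          case True
          then have "(F has_derivative (\<lambda>h. g x * h)) (at x within {a..b})"
            using der False by (simp add: has_field_derivative_def)
          from this[unfolded has_derivative_within_alt] half_gt_zero[OF \<open>e > 0\<close>]
          obtain r where "r > 0"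
            "\<forall>y\<in>{a..b}. norm (y - x) < r \<longrightarrow> norm (F y - F x - g x * (y - x)) \<le> e/2 * norm (y - x)"
            by blast
          then show ?thesis using False unfolding good_def by blast
        next
          case nab: False
          then show ?thesis using False zero_less_one unfolding good_def by blast
        qed
      qed
      then obtain r where "\<And>x. r x > 0" and good: "\<And>x. good x (r x)"
        by metis
      then have r: "\<And>x. r x > 0" "\<And>x. x \<in> N \<Longrightarrow> ball x (r x) \<subseteq> U"
        "\<And>x y. x \<in> {a..b} - N \<Longrightarrow> y \<in> {a..b} \<Longrightarrow> norm (y - x) < r x \<Longrightarrow>
           norm (F y - F x - g x * (y - x)) \<le> e/2 * norm (y - x)"
        unfolding good_def by blast+
      show ?thesis
      proof (intro exI[of _ "\<lambda>x. ball x (r x)"] conjI allI impI)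
        show "gauge (\<lambda>x. ball x (r x))" using r(1) by (rule gauge_ball_dependent[rule_format])
        fix p assume p: "p tagged_division_of cbox a b \<and> (\<lambda>x. ball x (r x)) fine p"
        then have pt: "p tagged_division_of cbox a b" and fine: "(\<lambda>x. ball x (r x)) fine p" by auto
        have fin: "finite p" using pt by blast
        define q where "q = {z \<in> p. fst z \<in> N}"
        have ba: "b - a = (\<Sum>(x,K)\<in>p. Sup K - Inf K)" "F b - F a = (\<Sum>(x,K)\<in>p. F (Sup K) - F (Inf K))"
          using additive_tagged_division_1[where f= "\<lambda>x. x"] additive_tagged_division_1[where f=F]
            \<open>a \<le> b\<close> pt by auto
        have mem: "\<exists>u v. K = {u..v} \<and> u \<le> x \<and> x \<le> v \<and> a \<le> u \<and> v \<le> b \<and> {u..v} \<subseteq> ball x (r x)" if xK: "(x, K) \<in> p" for x K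
        proof -
          obtain u v where K: "K = cbox u v"
            using tagged_division_ofD(4)[OF pt xK] by blast
          have "x \<in> K" "K \<subseteq> cbox a b" using tagged_division_ofD(2,3)[OF pt that] .
          then have "u \<le> x" "x \<le> v" "a \<le> u" "v \<le> b" unfolding K by auto
          moreover have "K \<subseteq> ball x (r x)" using fineD[OF fine that] .
          ultimately show ?thesis unfolding K cbox_interval by blast
        qed
        have qt: "q tagged_partial_division_of cbox a b"
          using pt tagged_partial_division_subset[of p "cbox a b" q] by (auto simp: tagged_division_of_def q_def)
        have qdiv: "(snd ` q) division_of \<Union>(snd ` q)" by (rule partial_division_of_tagged_division[OF qt])
        have qmem: "\<exists>u v. K = {u..v} \<and> u \<le> v \<and> a \<le> u \<and> v \<le> b \<and> K \<subseteq> U" if "K \<in> snd ` q" for K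
          using that mem r(2) unfolding q_def by fastforce
        \<comment> \<open>Non-overlapping intervals inside \<open>U\<close> have total length at
          most the measure of \<open>U\<close>, hence below \<delta>.\<close>
        have "(\<Sum>K\<in>snd ` q. Sup K - Inf K) = (\<Sum>K\<in>snd ` q. measure lebesgue K)"
        proof (rule sum.cong[OF refl])
          fix K assume "K \<in> snd ` q"
          then obtain u v where "K = {u..v}" "u \<le> v" using qmem by blast
          then show "Sup K - Inf K = measure lebesgue K" by simp
        qed
        also have "\<dots> = measure lebesgue (\<Union>(snd ` q))" by (rule content_division[OF qdiv])
        also have "\<dots> \<le> measure lebesgue U"
          using qmem U(3) qdiv by (intro measure_mono_fmeasurable) (auto simp: lmeasurable_division fmeasurableD)
        finally have "(\<Sum>K\<in>snd ` q. Sup K - Inf K) < \<delta>" using U by simp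
        moreover have "\<Union>(snd ` q) \<subseteq> {a..b}" using qmem by fastforce
        ultimately have small: "(\<Sum>K\<in>snd ` q. \<bar>F (Sup K) - F (Inf K)\<bar>) < e'" using qdiv \<delta>(2) by blast
        have bad: "(\<Sum>(x,K)\<in>q. \<bar>F (Sup K) - F (Inf K)\<bar>) < e'"
          using small
            sum_over_tagged_partial_division[OF qt, of "\<lambda>K. \<bar>F (Sup K) - F (Inf K)\<bar>"]
          by simp
        \<comment> \<open>The tag lies between the endpoints, so the errors from it to each endpoint
          add up to \<open>e/2\<close> times the length.\<close>
        have good_tag: "norm (measure lborel K *\<^sub>R h x - (F (Sup K) - F (Inf K))) \<le> e/2 * (Sup K - Inf K)"
          if xK: "(x, K) \<in> p - q" for x K
        proof -
          have xp: "(x, K) \<in> p" "x \<notin> N" using xK by (auto simp: q_def)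
          then obtain u v where K: "K = {u..v}" "u \<le> x" "x \<le> v" "a \<le> u" "v \<le> b" "{u..v} \<subseteq> ball x (r x)"
            using mem by blast
          then have "u \<in> ball x (r x)" "v \<in> ball x (r x)"
            by (meson atLeastAtMost_iff order.trans order_refl subsetD)+
          then have "norm (F u - F x - g x * (u - x)) \<le> e/2 * norm (u - x)"
              "norm (F v - F x - g x * (v - x)) \<le> e/2 * norm (v - x)"
            using K xp r(3)[of x u] r(3)[of x v] by (auto simp: dist_real_def)
          moreover have "(v - u) * g x - (F v - F u)
              = (F u - F x - g x * (u - x)) - (F v - F x - g x * (v - x))"
            by (simp add: algebra_simps)
          ultimately have "\<bar>(v - u) * g x - (F v - F u)\<bar> \<le> e/2 * \<bar>u - x\<bar> + e/2 * \<bar>v - x\<bar>"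
            by (simp only: real_norm_def)
          also have "\<dots> = e/2 * (v - u)" using K by (simp add: field_simps)
          finally show ?thesis using K xp by (simp add: h_def)
        qed
        have q0: "q \<subseteq> p" by (auto simp: q_def)
        have "norm ((\<Sum>(x, K)\<in>p. measure lborel K *\<^sub>R h x) - (F b - F a))
          = norm (\<Sum>(x, K)\<in>p. measure lborel K *\<^sub>R h x - (F (Sup K) - F (Inf K)))"
          unfolding ba by (simp add: sum_subtractf case_prod_unfold)
        also have "\<dots> = norm ((\<Sum>(x, K)\<in>p - q. measure lborel K *\<^sub>R h x - (F (Sup K) - F (Inf K)))
            + (\<Sum>(x, K)\<in>q. measure lborel K *\<^sub>R h x - (F (Sup K) - F (Inf K))))"
          by (simp only: sum.subset_diff[OF q0 fin])
        also have "\<dots> \<le> (\<Sum>(x, K)\<in>p - q. e/2 * (Sup K - Inf K)) + (\<Sum>(x,K)\<in>q. \<bar>F (Sup K) - F (Inf K)\<bar>)"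
        proof (rule norm_triangle_le, rule add_mono)
          show "norm (\<Sum>(x, K)\<in>p - q. measure lborel K *\<^sub>R h x - (F (Sup K) - F (Inf K))) \<le> (\<Sum>(x, K)\<in>p - q. e/2 * (Sup K - Inf K))"
            using good_tag by (intro sum_norm_le) auto
          show "norm (\<Sum>(x, K)\<in>q. measure lborel K *\<^sub>R h x - (F (Sup K) - F (Inf K))) \<le> (\<Sum>(x,K)\<in>q. \<bar>F (Sup K) - F (Inf K)\<bar>)"
            by (intro sum_norm_le) (auto simp: q_def h_def)
        qed
        also have "\<dots> \<le> (\<Sum>(x, K)\<in>p. e/2 * (Sup K - Inf K)) + e'"
        proof (intro add_mono sum_mono2)
          fix z assume "z \<in> p - (p - q)"
          then obtain x K where "z = (x, K)" "(x, K) \<in> p" by (cases z) auto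
          with mem[of x K] \<open>e > 0\<close> show "0 \<le> (case z of (x, K) \<Rightarrow> e/2 * (Sup K - Inf K))" by auto
        qed (use fin bad in auto)
        also have "(\<Sum>(x, K)\<in>p. e/2 * (Sup K - Inf K)) = e/2 * (b - a)"
          unfolding ba by (simp add: sum_distrib_left case_prod_unfold)
        finally show "norm ((\<Sum>(x, K)\<in>p. measure lborel K *\<^sub>R h x) - (F b - F a)) \<le> e * measure lborel (cbox a b)"
          using \<open>a < b\<close> by (simp add: e'_def algebra_simps)
      qed
    qed
  qed
  then show ?thesis
    by (intro has_integral_spike[OF N, of _ g h]) (auto simp: h_def)
qed

section \<open>Weak solutions\<close>

lemma C1_imp_abs_continuous:
  assumes "\<And>t. (y has_real_derivative p t) (at t)" "continuous_on {a..b} p"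
  shows "abs_continuous_on_interval a b y"
proof -
  have "bounded (p ` {a..b})" using assms(2) by (intro compact_imp_bounded compact_continuous_image) auto
  then obtain B where B: "\<forall>t\<in>{a..b}. norm (p t) \<le> B" unfolding bounded_iff by auto
  show ?thesis
  proof (rule lipschitz_imp_abs_continuous)
    fix s t assume "s \<in> {a..b}" "t \<in> {a..b}"
    then show "\<bar>y s - y t\<bar> \<le> B * \<bar>s - t\<bar>"
      using field_differentiable_bound[of "{a..b}" y p B s t]
        has_field_derivative_at_within[OF assms(1)] B by simp
  qed
qed

lemma set_integrable_imp_set_borel_measurable:
  "set_integrable M A h \<Longrightarrow> set_borel_measurable M A h"
  unfolding set_integrable_def set_borel_measurable_def by (rule borel_measurable_integrable)

lemma C1_in_H01:
  assumes y: "\<And>t. (y has_real_derivative p t) (at t)" and p: "continuous_on UNIV p"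
    and "y 0 = 0" "y 1 = 0"
  shows "y \<in> H01"
proof -
  have dy: "deriv y = p" using DERIV_imp_deriv[OF y] by auto
  have pc: "continuous_on {0..1} p" using p continuous_on_subset by blast
  have "set_integrable lebesgue {0..1} p" "set_integrable lebesgue {0..1} (\<lambda>t. (p t)\<^sup>2)"
    using pc by (intro absolutely_integrable_continuous_real continuous_intros; assumption)+
  moreover have "y differentiable (at t)" for t
    using y real_differentiable_def by blast
  ultimately show ?thesis
    unfolding H01_def dy using C1_imp_abs_continuous[OF y pc] assms(3,4)
    by (simp add: dy set_integrable_imp_set_borel_measurable)
qed

lemma H01D:
  assumes "v \<in> H01"
  shows "abs_continuous_on_interval 0 1 v" "v 0 = 0" "v 1 = 0"
    "set_borel_measurable lebesgue {0..1} (deriv v)" "set_integrable lebesgue {0..1} (\<lambda>t. (deriv v t)\<^sup>2)"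
  using assms unfolding H01_def mem_Collect_eq by blast+

text \<open>Outside \<open>N\<close>, \<open>deriv v\<close> is the true derivative and not an
  unspecified value.\<close>

lemma H01_has_derivative:
  assumes "v \<in> H01"
  obtains N where "negligible N" "\<And>t. t \<in> {0..1} - N \<Longrightarrow> (v has_real_derivative deriv v t) (at t)"
proof -
  have "AE t in lebesgue. t \<in> {0..1} \<longrightarrow> v differentiable (at t)" using assms by (simp add: H01_def)
  then obtain N where N: "N \<in> null_sets lebesgue" "{t. \<not> (t \<in> {0..1} \<longrightarrow> v differentiable (at t))} \<subseteq> N"
    unfolding eventually_ae_filter by auto
  show thesis
  proof (rule that[of N])
    show "negligible N" using N by (simp add: negligible_iff_null_sets)
    fix t assume "t \<in> {0..1} - N"
    then have "v differentiable (at t)" using N by auto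
    then show "(v has_real_derivative deriv v t) (at t)"
      using DERIV_deriv_iff_real_differentiable by blast
  qed
qed

text \<open>The product is dominated by \<open>g^2 + h^2\<close>.\<close>

lemma set_integrable_mult_of_square:
  fixes g h :: "'a \<Rightarrow> real"
  assumes "set_borel_measurable M A g" "set_borel_measurable M A h"
    and "set_integrable M A (\<lambda>t. (g t)\<^sup>2)" "set_integrable M A (\<lambda>t. (h t)\<^sup>2)"
  shows "set_integrable M A (\<lambda>t. g t * h t)"
proof (rule set_integrable_bound)
  show "set_integrable M A (\<lambda>t. (g t)\<^sup>2 + (h t)\<^sup>2)" using assms by (intro set_integral_add)
  have "(\<lambda>t. (indicator A t *\<^sub>R g t) * (indicator A t *\<^sub>R h t)) \<in> borel_measurable M"
    using assms(1,2) unfolding set_borel_measurable_def by (rule borel_measurable_times)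
  also have "(\<lambda>t. (indicator A t *\<^sub>R g t) * (indicator A t *\<^sub>R h t)) = (\<lambda>t. indicator A t *\<^sub>R (g t * h t))"
    by (rule ext) (simp split: split_indicator)
  finally show "set_borel_measurable M A (\<lambda>t. g t * h t)"
    unfolding set_borel_measurable_def .
  have "\<bar>a * b\<bar> \<le> a\<^sup>2 + b\<^sup>2" for a b :: real
  proof -
    have "2 * \<bar>a * b\<bar> \<le> a\<^sup>2 + b\<^sup>2"
      using sum_squares_bound[of "\<bar>a\<bar>" "\<bar>b\<bar>"] by (simp add: abs_mult)
    moreover have "0 \<le> \<bar>a * b\<bar>" by simp
    ultimately show ?thesis by linarith
  qed
  then show "AE t in M. t \<in> A \<longrightarrow> norm (g t * h t) \<le> norm ((g t)\<^sup>2 + (h t)\<^sup>2)"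
    by (auto simp: abs_mult)
qed

lemma H01_deriv_mult_integrable:
  assumes "v \<in> H01" "w \<in> H01"
  shows "set_integrable lebesgue {0..1} (\<lambda>t. deriv v t * deriv w t)"
  using H01D(4,5)[OF assms(1)] H01D(4,5)[OF assms(2)] by (intro set_integrable_mult_of_square)

lemma H01_continuous: "v \<in> H01 \<Longrightarrow> continuous_on {0..1} v"
  by (intro abs_continuous_imp_continuous_on H01D)

text \<open>Integration by parts: the absolutely continuous product \<open>p * v\<close> has
  derivative \<open>p v' + g v\<close> almost everywhere and vanishes at both ends because
  \<open>v\<close> does.\<close>

lemma classical_imp_weak_solution:
  assumes y: "\<And>t. (y has_real_derivative p t) (at t)" and p: "\<And>t. (p has_real_derivative g t) (at t)"
    and g: "continuous_on UNIV g" and eq: "\<And>t. t \<in> {0..1} \<Longrightarrow> g t = f t (y t)"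
    and "y 0 = 0" "y 1 = 0"
  shows "weak_solution f y"
  unfolding weak_solution_def
proof (intro conjI ballI)
  have "continuous_on UNIV p" using p by (meson DERIV_isCont continuous_at_imp_continuous_on)
  then show yH: "y \<in> H01" using C1_in_H01[OF y] assms(5,6) by blast
  have dy: "deriv y = p" using DERIV_imp_deriv[OF y] by auto
  fix v assume v: "v \<in> H01"
  then obtain N where N: "negligible N"
    "\<And>t. t \<in> {0..1} - N \<Longrightarrow> (v has_real_derivative deriv v t) (at t)"
    using H01_has_derivative by metis
  have gc: "continuous_on {0..1} g" using g continuous_on_subset by blast
  have "((\<lambda>t. p t * deriv v t + g t * v t) has_integral p 1 * v 1 - p 0 * v 0) {0..1}"
  proof (rule fundamental_theorem_of_calculus_abs_continuous[OF _ _ N(1)])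
    show "abs_continuous_on_interval 0 1 (\<lambda>t. p t * v t)"
      by (intro abs_continuous_mult C1_imp_abs_continuous[OF p gc] H01D(1)[OF v])
    fix t assume "t \<in> {0..1} - N"
    from DERIV_mult[OF p N(2)[OF this]]
    show "((\<lambda>t. p t * v t) has_real_derivative p t * deriv v t + g t * v t) (at t within {0..1})"
      by (rule has_field_derivative_at_within[OF DERIV_cong]) (simp add: add.commute mult.commute)
  qed simp
  then have zero: "((\<lambda>t. p t * deriv v t + g t * v t) has_integral 0) {0..1}"
    by (simp add: H01D[OF v])
  have int1: "set_integrable lebesgue {0..1} (\<lambda>t. p t * deriv v t)"
    using H01_deriv_mult_integrable[OF yH v] by (simp add: dy)
  have int2: "set_integrable lebesgue {0..1} (\<lambda>t. g t * v t)"
    by (intro absolutely_integrable_continuous_real continuous_intros gc H01_continuous v)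
  \<comment> \<open>The zero is a gauge integral; absolute integrability of both summands transfers
    it to the Lebesgue integral.\<close>
  have "(LINT t:{0..1}|lebesgue. p t * deriv v t + g t * v t) = 0"
    using has_integral_set_lebesgue[OF set_integral_add(1)[OF int1 int2]] zero has_integral_unique by blast
  moreover have "(LINT t:{0..1}|lebesgue. g t * v t) = (LINT t:{0..1}|lebesgue. f t (y t) * v t)"
    by (intro set_lebesgue_integral_cong) (auto simp: eq)
  ultimately show "(LINT t:{0..1}|lebesgue. deriv y t * deriv v t) + (LINT t:{0..1}|lebesgue. f t (y t) * v t) = 0"
    using set_integral_add(2)[OF int1 int2] by (simp add: dy)
qed

lemma weak_solution_unique:
  assumes cont: "continuous_on ({0..1} \<times> UNIV) (\<lambda>(t, x). f t x)"
    and mono: "\<And>t. t \<in> {0..1} \<Longrightarrow> mono (f t)"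
    and x: "weak_solution f x" and y: "weak_solution f y" and s: "s \<in> {0..1}"
  shows "y s = x s"
proof -
  have xH: "x \<in> H01" and yH: "y \<in> H01" using x y by (auto simp: weak_solution_def)
  have J_int: "set_integrable lebesgue {0..1} (\<lambda>t. f t (a t) * b t)" if "a \<in> H01" "b \<in> H01" for a b
  proof -
    have "continuous_on {0..1} (\<lambda>t. (\<lambda>(t, x). f t x) (t, a t))"
      using H01_continuous[OF that(1)]
      by (intro continuous_on_compose2[OF cont]) (auto intro: continuous_intros)
    then have "continuous_on {0..1} (\<lambda>t. f t (a t))" by simp
    then show ?thesis
      by (intro absolutely_integrable_continuous_real continuous_on_mult H01_continuous[OF that(2)])
  qed
  note I_int = H01_deriv_mult_integrable
  have weak: "(LINT t:{0..1}|lebesgue. deriv a t * deriv b t) + (LINT t:{0..1}|lebesgue. f t (a t) * b t) = 0"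
    if "a \<in> {x, y}" "b \<in> {x, y}" for a b
    using that x y xH yH unfolding weak_solution_def by blast
  define W where "W a b t = deriv a t * deriv b t + f t (a t) * b t" for a b t
  have W_int: "set_integrable lebesgue {0..1} (W a b)" if "a \<in> H01" "b \<in> H01" for a b
    unfolding W_def using that by (intro set_integral_add I_int J_int)
  have W0: "(LINT t:{0..1}|lebesgue. W a b t) = 0" if "a \<in> {x, y}" "b \<in> {x, y}" for a b
    using weak[OF that] that xH yH set_integral_add(2)[OF I_int J_int, of a b a b] unfolding W_def by auto
  \<comment> \<open>Testing each equation with \<open>x\<close> and with \<open>y\<close> separately
    and combining the four results stands in for the test function \<open>y - x\<close>. The
    integrand becomes a square plus a term that monotonicity makes nonnegative.\<close>
  define h where "h t = (W y y t - W y x t) - (W x y t - W x x t)" for t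
  have h_eq: "h t = (deriv y t - deriv x t)\<^sup>2 + (f t (y t) - f t (x t)) * (y t - x t)" for t
    unfolding h_def W_def by (simp add: power2_eq_square algebra_simps)
  have h_int: "set_integrable lebesgue {0..1} h"
    unfolding h_def using xH yH by (intro set_integral_diff W_int)
  have "(LINT t:{0..1}|lebesgue. h t) = 0"
    unfolding h_def using xH yH by (simp add: set_integral_diff W_int W0)
  have f_nonneg: "0 \<le> (f t (y t) - f t (x t)) * (y t - x t)" if "t \<in> {0..1}" for t
  proof (cases "x t \<le> y t")
    case True
    then show ?thesis using monoD[OF mono[OF that] True] by simp
  next
    case False
    then show ?thesis using monoD[OF mono[OF that], of "y t" "x t"] by (simp add: mult_nonpos_nonpos)
  qed
  have h_nonneg: "0 \<le> indicator {0..1} t *\<^sub>R h t" for t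
    using f_nonneg[of t] by (simp add: h_eq indicator_def)
  \<comment> \<open>A nonnegative integrable function with integral zero vanishes almost
    everywhere.\<close>
  have "AE t in lebesgue. indicator {0..1} t *\<^sub>R h t = 0"
    using \<open>(LINT t:{0..1}|lebesgue. h t) = 0\<close> h_int h_nonneg
    unfolding set_lebesgue_integral_def set_integrable_def
    by (subst integral_nonneg_eq_0_iff_AE[symmetric]) auto
  then obtain N0 where N0: "N0 \<in> null_sets lebesgue" "{t. indicator {0..1} t *\<^sub>R h t \<noteq> 0} \<subseteq> N0"
    unfolding eventually_ae_filter by auto
  have deriv_eq: "deriv y t = deriv x t" if "t \<in> {0..1} - N0" for t
  proof -
    have "h t = 0" using N0(2) that by (auto simp: indicator_def)
    moreover have "0 \<le> (f t (y t) - f t (x t)) * (y t - x t)" using f_nonneg that by blast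
    ultimately have "(deriv y t - deriv x t)\<^sup>2 = 0"
      using zero_le_power2[of "deriv y t - deriv x t"] unfolding h_eq by linarith
    then show ?thesis by simp
  qed
  obtain N1 where N1: "negligible N1" "\<And>t. t \<in> {0..1} - N1 \<Longrightarrow> (x has_real_derivative deriv x t) (at t)"
    using H01_has_derivative[OF xH] by metis
  obtain N2 where N2: "negligible N2" "\<And>t. t \<in> {0..1} - N2 \<Longrightarrow> (y has_real_derivative deriv y t) (at t)"
    using H01_has_derivative[OF yH] by metis
  \<comment> \<open>Absolute continuity is essential here: it lets an almost everywhere zero
    derivative force \<open>y - x\<close> to be constant on \<open>{0..s}\<close>.\<close>
  have "((\<lambda>t. 0) has_integral (y s - x s) - (y 0 - x 0)) {0..s}"
  proof (rule fundamental_theorem_of_calculus_abs_continuous[where N = "N0 \<union> N1 \<union> N2"])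
    show "negligible (N0 \<union> N1 \<union> N2)"
      using N0(1) N1(1) N2(1) by (intro negligible_Un) (simp_all add: negligible_iff_null_sets)
    have "abs_continuous_on_interval 0 1 (\<lambda>t. y t - x t)"
      using xH yH by (intro abs_continuous_diff H01D(1))
    then show "abs_continuous_on_interval 0 s (\<lambda>t. y t - x t)"
      by (rule abs_continuous_on_interval_subset) (use s in auto)
    fix t assume t: "t \<in> {0..s} - (N0 \<union> N1 \<union> N2)"
    then have "((\<lambda>t. y t - x t) has_real_derivative deriv y t - deriv x t) (at t)"
      using s by (intro DERIV_diff N1 N2) auto
    then show "((\<lambda>t. y t - x t) has_real_derivative 0) (at t within {0..s})"
      using deriv_eq[of t] t s has_field_derivative_at_within by fastforce
  qed (use s in auto)
  then have "(y s - x s) - (y 0 - x 0) = 0" using has_integral_0 has_integral_unique by blast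
  then show ?thesis by (simp add: H01D[OF xH] H01D[OF yH])
qed

theorem theorem4:
  fixes f :: "real \<Rightarrow> real \<Rightarrow> real"
  assumes "continuous_on ({0..1} \<times> UNIV) (\<lambda>(t, x). f t x)"
    and "\<And>t. t \<in> {0..1} \<Longrightarrow> f t 0 \<noteq> 0"
    and "\<And>t. t \<in> {0..1} \<Longrightarrow> mono (f t)"
  shows "\<exists>(x :: real \<Rightarrow> real) (X :: nat \<Rightarrow> nat \<Rightarrow> real).
           x \<in> H01 \<and> C2_on {0<..<1} x \<and> weak_solution f x \<and>
           (\<forall>t\<in>{0<..<1}. deriv (deriv x) t = f t (x t)) \<and>
           (\<forall>y. weak_solution f y \<longrightarrow> (\<forall>t\<in>{0..1}. y t = x t)) \<and>
           (\<forall>n\<ge>1. discrete_solution f n (X n) \<and>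
                   (\<forall>u. discrete_solution f n u \<longrightarrow> (\<forall>k\<in>{0..n}. u k = X n k))) \<and>
           (\<exists>r :: nat \<Rightarrow> nat. strict_mono r \<and> (\<forall>m. r m \<ge> 1) \<and>
              (\<lambda>m. MAX k\<in>{0..r m}. \<bar>X (r m) k - x (real k / real (r m))\<bar>) \<longlonglongrightarrow> 0)"
proof -
  note cont = assms(1) and mono = assms(3)
  have f_cont: "continuous_on UNIV (f t)" if "t \<in> {0..1}" for t
  proof -
    have "continuous_on UNIV (\<lambda>x. (\<lambda>(t, x). f t x) (t, x))"
      using that by (intro continuous_on_compose2[OF cont]) (auto intro: continuous_intros)
    then show ?thesis by simp
  qed
  \<comment> \<open>Existence is invoked for \<open>n\<close> \<ge> 1 only; \<open>r m\<close> is at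
    least 1, so \<open>X 0\<close> never enters the limit.\<close>
  define X where "X n = (SOME u. discrete_solution f n u)" for n
  have X: "discrete_solution f n (X n)" if "1 \<le> n" for n
    unfolding X_def using discrete_solution_exists[OF f_cont mono that] by (rule someI_ex)
  obtain x p g :: "real \<Rightarrow> real" and r :: "nat \<Rightarrow> nat"
    where x: "\<And>t. (x has_real_derivative p t) (at t)" and p: "\<And>t. (p has_real_derivative g t) (at t)"
    and g: "continuous_on UNIV g" "\<And>t. t \<in> {0..1} \<Longrightarrow> g t = f t (x t)"
    and x01: "x 0 = 0" "x 1 = 0" and r: "strict_mono r" "\<And>m. 1 \<le> r m"
    and conv: "\<And>\<epsilon>. 0 < \<epsilon> \<Longrightarrow>
      \<forall>\<^sub>F m in sequentially. \<forall>k\<le>r m. \<bar>X (r m) k - x (real k / real (r m))\<bar> \<le> \<epsilon>"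
    by (rule discrete_solutions_subconverge[OF cont mono X]) (assumption | rule that)+
  have p_cont: "continuous_on UNIV p" using p by (meson DERIV_isCont continuous_at_imp_continuous_on)
  have dx: "deriv x = p" "deriv p = g" using DERIV_imp_deriv[OF x] DERIV_imp_deriv[OF p] by auto
  have weak: "weak_solution f x" by (rule classical_imp_weak_solution[of x p g f, OF x p g x01])
  have C2: "C2_on {0<..<1} x"
    unfolding C2_on_def dx C1_differentiable_on_def
    using x p continuous_on_subset[OF p_cont] continuous_on_subset[OF g(1)]
    unfolding has_real_derivative_iff_has_vector_derivative by blast
  have lim: "(\<lambda>m. MAX k\<in>{0..r m}. \<bar>X (r m) k - x (real k / real (r m))\<bar>) \<longlonglongrightarrow> 0"
  proof (rule tendstoI)
    fix e :: real assume "0 < e"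
    then have "0 < e / 2" by simp
    from conv[OF this]
    show "\<forall>\<^sub>F m in sequentially. dist (MAX k\<in>{0..r m}. \<bar>X (r m) k - x (real k / real (r m))\<bar>) 0 < e"
    proof eventually_elim
      case (elim m)
      let ?D = "(\<lambda>k. \<bar>X (r m) k - x (real k / real (r m))\<bar>) ` {0..r m}"
      \<comment> \<open>The maximum is attained at some node, where the uniform bound
        \<open>e / 2\<close> applies.\<close>
      have "Max ?D \<in> ?D" by (intro Max_in) auto
      then obtain k where "k \<le> r m" "Max ?D = \<bar>X (r m) k - x (real k / real (r m))\<bar>"
        unfolding atLeast0AtMost image_iff atMost_iff Bex_def by blast
      then have "0 \<le> Max ?D" "Max ?D \<le> e / 2" using elim by simp_all
      then show ?case using \<open>0 < e\<close> unfolding dist_real_def by linarith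
    qed
  qed
  show ?thesis
  proof (intro exI[of _ x] exI[of _ X] exI[of _ r] conjI allI impI ballI)
    show "x \<in> H01" using weak by (simp add: weak_solution_def)
    show "deriv (deriv x) t = f t (x t)" if "t \<in> {0<..<1}" for t
      using g(2)[of t] that by (simp add: dx)
    show "y t = x t" if "weak_solution f y" "t \<in> {0..1}" for y t
      using weak_solution_unique[OF cont mono weak] that by blast
    show "u k = X n k" if "1 \<le> n" "discrete_solution f n u" "k \<in> {0..n}" for n u k
      using discrete_solution_unique[OF mono that(2) X[OF that(1)]] that(3) by simp
  qed (use C2 weak X r lim in auto)
qed

end
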